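(* Every almost strongly proper forcing preserves c.c.c.-ness; that is, if $\mathbb P$ is an almost strongly proper forcing and $\mathbb Q$ is a c.c.c. forcing, then for every $V$-generic filter $G\subseteq\mathbb P$, $\mathbb Q$ is c.c.c. in $V[G]$.
   Context: For a set $Z$, $[Z]^{\omega}$ is the set of countably infinite subsets of $Z$. An algebra over $Z$ is a function $F:[Z]^{<\omega}\to Z$; $A\subseteq Z$ is $F$-closed if $F(s)\in A$ for all finite $s\subseteq A$. For conditions $r,q$, $r\,\|\,q$ means that $r$ and $q$ are compatible. Let $\mathbb P$ be a forcing and $M\prec H_\vartheta$ with $[\mathbb P]^\omega\in M$. A condition $p\in\mathbb P$ is $(M,\mathbb P)$-almost strongly generic if for every $q\le p$ the set $$S_q=\{Y\in[\mathbb P]^\omega:\ \exists\, q'\in Y\ \ \forall r\in Y\ (r\le q'\Rightarrow r\,\|\,q)\}$$ is $M$-stationary, i.e. for every algebra $F\in M$ over $\mathbb P$ there is an $F$-closed $A\in M\cap S_q$. The forcing $\mathbb P$ is almost strongly proper (a.s.p.) if for every sufficiently large regular cardinal $\vartheta$ there is a club (in $[H_\vartheta]^\omega$) of countable models $M\prec H_\vartheta$ with $[\mathbb P]^\omega\in M$ such that every $p\in M\cap\mathbb P$ can be extended to an $(M,\mathbb P)$-almost strongly generic condition. *)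

theory Defs
  imports "HOL-Library.Countable_Set" "HOL-Library.Equipollence"
begin

section \<open>The set-theoretic universe\<close>

text \<open>
  A type of this class is a universe \<open>V\<close> of ZFC sets. Replacement is stated for arbitrary HOL
  relations, so separation follows from it, and Choice follows from Hilbert choice. Consequently
  every subcollection of a set is a set, and HOL's \<^const>\<open>finite\<close>, \<^const>\<open>countable\<close>
  and \<^const>\<open>lesspoll\<close> on extensions agree with the notions computed inside \<open>V\<close>.
\<close>

class zfc =
  fixes vmem :: "'a \<Rightarrow> 'a \<Rightarrow> bool"  (infix \<open>\<in>\<^sub>V\<close> 50)
  assumes extensionality: "(\<forall>z. z \<in>\<^sub>V x \<longleftrightarrow> z \<in>\<^sub>V y) \<Longrightarrow> x = y"
    and foundation: "wf {(x, y). x \<in>\<^sub>V y}"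
    and pairing: "\<exists>u. x \<in>\<^sub>V u \<and> y \<in>\<^sub>V u"
    and union: "\<exists>u. \<forall>z. z \<in>\<^sub>V u \<longleftrightarrow> (\<exists>y. y \<in>\<^sub>V x \<and> z \<in>\<^sub>V y)"
    and power_set: "\<exists>u. \<forall>z. z \<in>\<^sub>V u \<longleftrightarrow> (\<forall>w. w \<in>\<^sub>V z \<longrightarrow> w \<in>\<^sub>V x)"
    and infinity: "\<exists>u. (\<exists>z. z \<in>\<^sub>V u \<and> (\<forall>w. \<not> w \<in>\<^sub>V z)) \<and>
      (\<forall>y. y \<in>\<^sub>V u \<longrightarrow> (\<exists>s. s \<in>\<^sub>V u \<and> (\<forall>z. z \<in>\<^sub>V s \<longleftrightarrow> z \<in>\<^sub>V y \<or> z = y)))"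
    and replacement: "(\<forall>w y z. S w y \<and> S w z \<longrightarrow> y = z) \<Longrightarrow>
      \<exists>u. \<forall>z. z \<in>\<^sub>V u \<longleftrightarrow> (\<exists>w. w \<in>\<^sub>V x \<and> S w z)"

definition elts :: "'v::zfc \<Rightarrow> 'v set" where
  "elts x = {y. y \<in>\<^sub>V x}"

text \<open>Only meaningful if some element of \<open>V\<close> has extension \<open>X\<close>.\<close>

definition vset :: "'v::zfc set \<Rightarrow> 'v" where
  "vset X = (THE x. elts x = X)"

definition pair :: "'v::zfc \<Rightarrow> 'v \<Rightarrow> 'v" where
  "pair x y = vset {vset {x}, vset {x, y}}"

definition tc :: "'v::zfc \<Rightarrow> 'v set" where
  "tc x = {y. vmem\<^sup>+\<^sup>+ y x}"

definition transitive_set :: "'v::zfc \<Rightarrow> bool" where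
  "transitive_set x \<longleftrightarrow> (\<forall>y \<in> elts x. elts y \<subseteq> elts x)"

definition ordinal :: "'v::zfc \<Rightarrow> bool" where
  "ordinal x \<longleftrightarrow> transitive_set x \<and> (\<forall>y \<in> elts x. transitive_set y)"

definition regular_cardinal :: "'v::zfc \<Rightarrow> bool" where
  "regular_cardinal \<theta> \<longleftrightarrow> ordinal \<theta> \<and> infinite (elts \<theta>) \<and>
     (\<forall>\<alpha> \<in> elts \<theta>. elts \<alpha> \<prec> elts \<theta>) \<and>
     (\<forall>X \<subseteq> elts \<theta>. X \<prec> elts \<theta> \<longrightarrow> (\<exists>\<beta> \<in> elts \<theta>. X \<subseteq> elts \<beta>))"

text \<open>\<open>H\<^sub>\<theta>\<close>, the sets hereditarily of cardinality less than \<open>\<theta>\<close>.\<close>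

definition H :: "'v::zfc \<Rightarrow> 'v set" where
  "H \<theta> = {x. tc x \<prec> elts \<theta>}"

definition ctbl_subsets :: "'b set \<Rightarrow> 'b set set" where
  "ctbl_subsets X = {Y. Y \<subseteq> X \<and> countable Y \<and> infinite Y}"

definition club_in :: "'b set set \<Rightarrow> 'b set \<Rightarrow> bool" where
  "club_in C X \<longleftrightarrow> C \<subseteq> ctbl_subsets X \<and>
     (\<forall>Y \<in> ctbl_subsets X. \<exists>Z \<in> C. Y \<subseteq> Z) \<and>
     (\<forall>f::nat \<Rightarrow> 'b set. (\<forall>n. f n \<in> C) \<and> mono f \<longrightarrow> (\<Union>n. f n) \<in> C)"


section \<open>First-order formulas and elementary submodels\<close>

text \<open>Formulas of the language of set theory with named variables \<open>v\<^sub>0, v\<^sub>1, \<dots>\<close>.\<close>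

datatype fm = Mem nat nat | Equal nat nat | Neg fm | Conj fm fm | All nat fm

definition Imp :: "fm \<Rightarrow> fm \<Rightarrow> fm" where "Imp \<phi> \<psi> = Neg (Conj \<phi> (Neg \<psi>))"
definition Disj :: "fm \<Rightarrow> fm \<Rightarrow> fm" where "Disj \<phi> \<psi> = Neg (Conj (Neg \<phi>) (Neg \<psi>))"
definition Iff :: "fm \<Rightarrow> fm \<Rightarrow> fm" where "Iff \<phi> \<psi> = Conj (Imp \<phi> \<psi>) (Imp \<psi> \<phi>)"
definition Ex :: "nat \<Rightarrow> fm \<Rightarrow> fm" where "Ex i \<phi> = Neg (All i (Neg \<phi>))"
definition AllIn :: "nat \<Rightarrow> nat \<Rightarrow> fm \<Rightarrow> fm" where "AllIn i j \<phi> = All i (Imp (Mem i j) \<phi>)"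
definition ExIn :: "nat \<Rightarrow> nat \<Rightarrow> fm \<Rightarrow> fm" where "ExIn i j \<phi> = Ex i (Conj (Mem i j) \<phi>)"

primrec sat :: "'v::zfc set \<Rightarrow> fm \<Rightarrow> (nat \<Rightarrow> 'v) \<Rightarrow> bool" where
  "sat M (Mem i j) e \<longleftrightarrow> e i \<in>\<^sub>V e j"
| "sat M (Equal i j) e \<longleftrightarrow> e i = e j"
| "sat M (Neg \<phi>) e \<longleftrightarrow> \<not> sat M \<phi> e"
| "sat M (Conj \<phi> \<psi>) e \<longleftrightarrow> sat M \<phi> e \<and> sat M \<psi> e"
| "sat M (All i \<phi>) e \<longleftrightarrow> (\<forall>x \<in> M. sat M \<phi> (e(i := x)))"

definition elementary_submodel :: "'v::zfc set \<Rightarrow> 'v set \<Rightarrow> bool" where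
  "elementary_submodel M N \<longleftrightarrow> M \<noteq> {} \<and> M \<subseteq> N \<and>
     (\<forall>\<phi> e. range e \<subseteq> M \<longrightarrow> (sat M \<phi> e \<longleftrightarrow> sat N \<phi> e))"


section \<open>Forcing notions\<close>

text \<open>
  A forcing is a nonempty preorder whose carrier \<open>P\<close> and order \<open>R\<close> (a set of ordered pairs) are
  elements of \<open>V\<close>. Neither antisymmetry nor a largest condition is required.
\<close>

definition le :: "'v::zfc \<Rightarrow> 'v \<Rightarrow> 'v \<Rightarrow> bool" where
  "le R p q \<longleftrightarrow> pair p q \<in>\<^sub>V R"

definition forcing :: "'v::zfc \<Rightarrow> 'v \<Rightarrow> bool" where
  "forcing P R \<longleftrightarrow> elts P \<noteq> {} \<and>
     elts R \<subseteq> (\<lambda>(p, q). pair p q) ` (elts P \<times> elts P) \<and>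
     (\<forall>p \<in> elts P. le R p p) \<and>
     (\<forall>p \<in> elts P. \<forall>q \<in> elts P. \<forall>r \<in> elts P. le R p q \<longrightarrow> le R q r \<longrightarrow> le R p r)"

definition compatible :: "'v::zfc \<Rightarrow> 'v \<Rightarrow> 'v \<Rightarrow> 'v \<Rightarrow> bool" where
  "compatible P R p q \<longleftrightarrow> (\<exists>r \<in> elts P. le R r p \<and> le R r q)"

definition ccc :: "'v::zfc \<Rightarrow> 'v \<Rightarrow> bool" where
  "ccc Q R \<longleftrightarrow> (\<forall>A \<subseteq> elts Q.
     (\<forall>p \<in> A. \<forall>q \<in> A. p \<noteq> q \<longrightarrow> \<not> compatible Q R p q) \<longrightarrow> countable A)"


section \<open>Almost strong properness\<close>

text \<open>The set \<open>[P]\<^sup>\<omega>\<close> as an element of \<open>V\<close>.\<close>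

definition vctbl_subsets :: "'v::zfc \<Rightarrow> 'v" where
  "vctbl_subsets P = vset {Y. elts Y \<in> ctbl_subsets (elts P)}"

text \<open>An algebra is a set-theoretic function, so that it makes sense to ask whether it lies in \<open>M\<close>.\<close>

definition algebra_over :: "'v::zfc \<Rightarrow> 'v \<Rightarrow> bool" where
  "algebra_over F Z \<longleftrightarrow>
     (\<forall>w \<in> elts F. \<exists>s z. w = pair s z \<and> elts s \<subseteq> elts Z \<and> finite (elts s) \<and> z \<in> elts Z) \<and>
     (\<forall>s. elts s \<subseteq> elts Z \<and> finite (elts s) \<longrightarrow> (\<exists>!z. pair s z \<in>\<^sub>V F))"

definition closed_under_algebra :: "'v::zfc \<Rightarrow> 'v \<Rightarrow> bool" where
  "closed_under_algebra F A \<longleftrightarrow>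
     (\<forall>s z. elts s \<subseteq> elts A \<and> finite (elts s) \<and> pair s z \<in>\<^sub>V F \<longrightarrow> z \<in> elts A)"

definition stationary_for :: "'v::zfc set \<Rightarrow> 'v \<Rightarrow> 'v set \<Rightarrow> bool" where
  "stationary_for M P S \<longleftrightarrow>
     (\<forall>F \<in> M. algebra_over F P \<longrightarrow> (\<exists>A \<in> M \<inter> S. closed_under_algebra F A))"

definition S_set :: "'v::zfc \<Rightarrow> 'v \<Rightarrow> 'v \<Rightarrow> 'v set" where
  "S_set P R q = {Y \<in> elts (vctbl_subsets P).
     \<exists>q' \<in> elts Y. \<forall>r \<in> elts Y. le R r q' \<longrightarrow> compatible P R r q}"

definition almost_strongly_generic :: "'v::zfc set \<Rightarrow> 'v \<Rightarrow> 'v \<Rightarrow> 'v \<Rightarrow> bool" where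
  "almost_strongly_generic M P R p \<longleftrightarrow> p \<in> elts P \<and>
     (\<forall>q \<in> elts P. le R q p \<longrightarrow> stationary_for M P (S_set P R q))"

definition almost_strongly_proper :: "'v::zfc \<Rightarrow> 'v \<Rightarrow> bool" where
  "almost_strongly_proper P R \<longleftrightarrow>
     (\<exists>\<kappa>. ordinal \<kappa> \<and> (\<forall>\<theta>. regular_cardinal \<theta> \<and> \<kappa> \<in>\<^sub>V \<theta> \<longrightarrow>
       (\<exists>C. club_in C (H \<theta>) \<and>
         (\<forall>M \<in> C. elementary_submodel M (H \<theta>) \<and> vctbl_subsets P \<in> M \<and>
           (\<forall>p \<in> M \<inter> elts P. \<exists>p'. le R p' p \<and> almost_strongly_generic M P R p')))))"


section \<open>Names and the forcing relation\<close>

inductive is_name :: "'v::zfc \<Rightarrow> 'v \<Rightarrow> bool" for P where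
  "(\<And>w. w \<in> elts \<tau> \<Longrightarrow> \<exists>\<sigma> s. w = pair \<sigma> s \<and> is_name P \<sigma> \<and> s \<in> elts P) \<Longrightarrow> is_name P \<tau>"

text \<open>
  A forcing need not have a largest condition, so the canonical name of \<open>x\<close> attaches every
  condition to every \<open>check P y\<close> with \<open>y \<in> x\<close>.
\<close>

function check :: "'v::zfc \<Rightarrow> 'v \<Rightarrow> 'v" where
  "check P x = vset ((\<lambda>(\<sigma>, p). pair \<sigma> p) ` (((\<lambda>y. check P y) ` elts x) \<times> elts P))"
  by auto
termination
  by (relation "inv_image {(x, y). x \<in>\<^sub>V y} snd") (auto simp: elts_def foundation)

declare check.simps [simp del]

text \<open>
  The forcing relation for atomic formulas:

  \<^item> \<open>p\<close> forces \<open>a \<in> b\<close> iff the \<open>r\<close> such that \<open>r \<le> s\<close> and \<open>r\<close> forces \<open>a = \<sigma>\<close>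
    for some \<open>(\<sigma>, s) \<in> b\<close> are dense below \<open>p\<close>;
  \<^item> \<open>p\<close> forces \<open>a = b\<close> iff for every \<open>(\<sigma>, s) \<in> a\<close>, every \<open>q \<le> p, s\<close> forces \<open>\<sigma> \<in> b\<close>,
    and symmetrically.

  This is a well-founded recursion on names whose clauses are monotone; the inductive
  definition therefore yields the unique solution of the two equivalences.
\<close>

inductive forces_mem :: "'v::zfc \<Rightarrow> 'v \<Rightarrow> 'v \<Rightarrow> 'v \<Rightarrow> bool"
  and forces_eq :: "'v \<Rightarrow> 'v \<Rightarrow> 'v \<Rightarrow> 'v \<Rightarrow> bool"
  for R where
  "(\<forall>q. le R q p \<longrightarrow>
      (\<exists>r \<sigma> s. le R r q \<and> pair \<sigma> s \<in>\<^sub>V b \<and> le R r s \<and> forces_eq R r a \<sigma>)) \<Longrightarrow>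
    forces_mem R p a b"
| "(\<forall>\<sigma> s q. pair \<sigma> s \<in>\<^sub>V a \<and> le R q p \<and> le R q s \<longrightarrow> forces_mem R q \<sigma> b) \<Longrightarrow>
   (\<forall>\<sigma> s q. pair \<sigma> s \<in>\<^sub>V b \<and> le R q p \<and> le R q s \<longrightarrow> forces_mem R q \<sigma> a) \<Longrightarrow>
    forces_eq R p a b"

text \<open>The environment \<open>e\<close> assigns names to the free variables.\<close>

primrec forces :: "'v::zfc \<Rightarrow> 'v \<Rightarrow> 'v \<Rightarrow> fm \<Rightarrow> (nat \<Rightarrow> 'v) \<Rightarrow> bool" where
  "forces P R p (Mem i j) e \<longleftrightarrow> forces_mem R p (e i) (e j)"
| "forces P R p (Equal i j) e \<longleftrightarrow> forces_eq R p (e i) (e j)"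
| "forces P R p (Neg \<phi>) e \<longleftrightarrow> (\<forall>q. le R q p \<longrightarrow> \<not> forces P R q \<phi> e)"
| "forces P R p (Conj \<phi> \<psi>) e \<longleftrightarrow> forces P R p \<phi> e \<and> forces P R p \<psi> e"
| "forces P R p (All i \<phi>) e \<longleftrightarrow> (\<forall>\<tau>. is_name P \<tau> \<longrightarrow> forces P R p \<phi> (e(i := \<tau>)))"

text \<open>
  ``\<open>V[G] \<Turnstile> \<phi>\<close> for every \<open>V\<close>-generic filter \<open>G \<subseteq> P\<close>'' has its usual meaning that every
  condition forces \<open>\<phi>\<close>; \<open>V\<close> itself contains no generic filters for atomless \<open>P\<close>.
\<close>

definition holds_in_generic_extensions :: "'v::zfc \<Rightarrow> 'v \<Rightarrow> fm \<Rightarrow> (nat \<Rightarrow> 'v) \<Rightarrow> bool" where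
  "holds_in_generic_extensions P R \<phi> e \<longleftrightarrow> (\<forall>p \<in> elts P. forces P R p \<phi> e)"


section \<open>The countable chain condition as a first-order formula\<close>

text \<open>
  Bound variables are distinct from all arguments: \<open>v\<^sub>1\<^sub>0, \<dots>, v\<^sub>1\<^sub>3\<close> are reserved for the
  auxiliary formulas up to \<open>fm_omega\<close>, and \<open>v\<^sub>9\<close> for \<open>fm_compatible\<close>.
\<close>

text \<open>\<open>z = {x, y}\<close>, \<open>z = (x, y)\<close> and \<open>(x, y) \<in> r\<close>:\<close>

definition fm_upair :: "nat \<Rightarrow> nat \<Rightarrow> nat \<Rightarrow> fm" where
  "fm_upair z x y = All 10 (Iff (Mem 10 z) (Disj (Equal 10 x) (Equal 10 y)))"

definition fm_pair :: "nat \<Rightarrow> nat \<Rightarrow> nat \<Rightarrow> fm" where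
  "fm_pair z x y = All 11 (Iff (Mem 11 z) (Disj (fm_upair 11 x x) (fm_upair 11 x y)))"

definition fm_rel :: "nat \<Rightarrow> nat \<Rightarrow> nat \<Rightarrow> fm" where
  "fm_rel r x y = ExIn 12 r (fm_pair 12 x y)"

text \<open>\<open>x = \<emptyset>\<close>, \<open>y = x \<union> {x}\<close>, \<open>u\<close> is inductive, and \<open>w = \<omega>\<close> is the least inductive set:\<close>

definition fm_empty :: "nat \<Rightarrow> fm" where
  "fm_empty x = All 10 (Neg (Mem 10 x))"

definition fm_succ :: "nat \<Rightarrow> nat \<Rightarrow> fm" where
  "fm_succ y x = All 10 (Iff (Mem 10 y) (Disj (Mem 10 x) (Equal 10 x)))"

definition fm_inductive :: "nat \<Rightarrow> fm" where
  "fm_inductive u = Conj (ExIn 11 u (fm_empty 11)) (AllIn 11 u (ExIn 12 u (fm_succ 12 11)))"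

definition fm_omega :: "nat \<Rightarrow> fm" where
  "fm_omega w = Conj (fm_inductive w)
     (All 13 (Imp (fm_inductive 13) (AllIn 11 w (Mem 11 13))))"

text \<open>For some \<open>v\<^sub>7\<close>, the restriction of \<open>v\<^sub>7\<close> to \<open>a\<close> is an injective function from \<open>a\<close> into \<open>\<omega>\<close>:\<close>

definition fm_countable :: "nat \<Rightarrow> fm" where
  "fm_countable a = Ex 6 (Conj (fm_omega 6) (Ex 7
     (Conj (AllIn 4 a (ExIn 5 6 (fm_rel 7 4 5)))
     (Conj (AllIn 4 a (All 5 (All 8
              (Imp (Conj (fm_rel 7 4 5) (fm_rel 7 4 8)) (Equal 5 8)))))
           (AllIn 4 a (AllIn 5 a (All 8
              (Imp (Conj (fm_rel 7 4 8) (fm_rel 7 5 8)) (Equal 4 5)))))))))"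

definition fm_compatible :: "nat \<Rightarrow> nat \<Rightarrow> nat \<Rightarrow> nat \<Rightarrow> fm" where
  "fm_compatible Q R x y = ExIn 9 Q (Conj (fm_rel R 9 x) (fm_rel R 9 y))"

text \<open>The forcing with carrier \<open>v\<^sub>0\<close> and order \<open>v\<^sub>1\<close> is c.c.c.:\<close>

definition fm_ccc :: fm where
  "fm_ccc = All 2 (Imp
     (Conj (AllIn 3 2 (Mem 3 0))
           (AllIn 3 2 (AllIn 4 2 (Imp (Neg (Equal 3 4)) (Neg (fm_compatible 0 1 3 4))))))
     (fm_countable 2))"

end

theory Submission
  imports Defs
begin

text \<open>
  Suppose \<open>p\<close> forces that \<open>\<tau>\<close> is an antichain of \<open>Q\<close>. For every condition \<open>x\<close> put
  \<open>E x = {b \<in> Q. \<exists>r \<le> x. r \<tturnstile> b \<in> \<tau>}\<close>. Since \<open>Q\<close> is c.c.c., some countable \<open>B x \<subseteq> E x\<close> meets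
  every element of \<open>E x\<close> in the sense of compatibility. Enumerate \<open>B x\<close> as \<open>b n x\<close>, choose
  \<open>g n x \<le> x\<close> forcing \<open>b n x \<in> \<tau>\<close>, and code all the functions \<open>g n\<close> into one algebra \<open>F\<close>. Let \<open>M\<close>
  be a countable model from the club with \<open>p, F \<in> M\<close>, and \<open>p' \<le> p\<close> almost strongly generic.

  If \<open>q \<le> p'\<close> forces \<open>a \<in> \<tau>\<close>, take an \<open>F\<close>-closed \<open>Y \<in> M\<close> in \<open>S\<^sub>q\<close>, with witness \<open>q' \<in> Y\<close>. As \<open>q'\<close> and \<open>q\<close>
  are compatible, \<open>a \<in> E q'\<close>, so \<open>a\<close> is compatible with some \<open>b n q'\<close>. Now \<open>g n q' \<in> Y\<close> is compatible with
  \<open>q\<close>, and a common extension forces both \<open>a\<close> and \<open>b n q'\<close> into the antichain, whence \<open>a = b n q'\<close>. Thus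
  \<open>p'\<close> forces \<open>\<tau>\<close> into the set of all \<open>b n x\<close> with \<open>x \<in> Y \<in> M\<close> for some countable \<open>Y\<close>, which is
  countable.
\<close>

section \<open>Sets, ordinals and successor cardinals\<close>

lemma mem_elts [simp]: "y \<in> elts x \<longleftrightarrow> y \<in>\<^sub>V x"
  by (simp add: elts_def)

lemma elts_inject [simp]: "elts x = elts y \<longleftrightarrow> x = y"
  using extensionality[of x y] by (auto simp: elts_def set_eq_iff)

text \<open>\<open>vset\<close> is a definite description; this predicate is what makes a use of it
  meaningful.\<close>

definition small :: "'v::zfc set \<Rightarrow> bool" where
  "small X \<longleftrightarrow> (\<exists>x. elts x = X)"

lemma small_elts [simp]: "small (elts x)"
  by (auto simp: small_def)

lemma elts_vset [simp]: "small X \<Longrightarrow> elts (vset X) = X"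
  unfolding small_def vset_def by (metis (mono_tags, lifting) elts_inject theI')

lemma mem_vset [simp]: "small X \<Longrightarrow> y \<in>\<^sub>V vset X \<longleftrightarrow> y \<in> X"
  using elts_vset mem_elts by blast

lemma small_image:
  fixes f :: "'v::zfc \<Rightarrow> 'v"
  assumes "small X"
  shows "small (f ` X)"
proof -
  obtain x where x: "elts x = X"
    using assms by (auto simp: small_def)
  have "\<exists>u. \<forall>z. z \<in>\<^sub>V u \<longleftrightarrow> (\<exists>w. w \<in>\<^sub>V x \<and> z = f w)"
    by (rule replacement[where S = "\<lambda>w z. z = f w"]) auto
  then obtain u where "\<forall>z. z \<in>\<^sub>V u \<longleftrightarrow> (\<exists>w. w \<in>\<^sub>V x \<and> z = f w)" ..
  then have "elts u = f ` X"
    using x by (auto simp: elts_def)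
  then show ?thesis
    by (auto simp: small_def)
qed

lemma small_subset:
  assumes "small X" "Y \<subseteq> X"
  shows "small Y"
proof -
  obtain x where x: "elts x = X"
    using assms by (auto simp: small_def)
  \<comment> \<open>Separation is replacement along the partial identity on
    \<open>Y\<close>.\<close>
  have "\<exists>u. \<forall>z. z \<in>\<^sub>V u \<longleftrightarrow> (\<exists>w. w \<in>\<^sub>V x \<and> (z = w \<and> w \<in> Y))"
    by (rule replacement) auto
  then obtain u where "\<forall>z. z \<in>\<^sub>V u \<longleftrightarrow> (\<exists>w. w \<in>\<^sub>V x \<and> (z = w \<and> w \<in> Y))" ..
  then have "elts u = Y"
    using x assms(2) by (auto simp: elts_def)
  then show ?thesis
    by (auto simp: small_def)
qed

lemma small_empty [simp]: "small {}"
  using small_subset[OF small_elts] by blast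

lemma small_upair: "small {x, y}"
proof -
  obtain u where "x \<in>\<^sub>V u" "y \<in>\<^sub>V u"
    using pairing by blast
  then show ?thesis
    by (intro small_subset[OF small_elts[of u]]) auto
qed

lemma small_singleton [simp]: "small {x}"
  using small_upair[of x x] by simp

lemma small_UN:
  fixes f :: "'v::zfc \<Rightarrow> 'v set"
  assumes "small X" "\<And>x. x \<in> X \<Longrightarrow> small (f x)"
  shows "small (\<Union>x\<in>X. f x)"
proof -
  obtain a where a: "elts a = (\<lambda>x. vset (f x)) ` X"
    using small_image[OF assms(1)] unfolding small_def by blast
  obtain u where "\<forall>z. z \<in>\<^sub>V u \<longleftrightarrow> (\<exists>y. y \<in>\<^sub>V a \<and> z \<in>\<^sub>V y)"
    using union by blast
  moreover have "y \<in>\<^sub>V a \<longleftrightarrow> (\<exists>x\<in>X. y = vset (f x))" for y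
    using a by (auto simp: set_eq_iff)
  ultimately have "elts u = (\<Union>x\<in>X. f x)"
    using assms(2) by (auto simp: set_eq_iff)
  then show ?thesis
    by (auto simp: small_def)
qed

lemma small_Un [simp]:
  assumes "small X" "small Y"
  shows "small (X \<union> Y)"
proof -
  \<comment> \<open>A binary union is the union over an unordered pair of codes.\<close>
  have "small (\<Union>z\<in>{vset X, vset Y}. elts z)"
    by (intro small_UN small_upair) auto
  then show ?thesis
    using assms by simp
qed

lemma small_insert [simp]: "small X \<Longrightarrow> small (insert x X)"
  using small_Un[of "{x}" X] by simp

lemma small_Pow: "small {y. elts y \<subseteq> elts x}"
proof -
  obtain u where "\<forall>z. z \<in>\<^sub>V u \<longleftrightarrow> (\<forall>w. w \<in>\<^sub>V z \<longrightarrow> w \<in>\<^sub>V x)"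
    using power_set by blast
  then have "elts u = {y. elts y \<subseteq> elts x}"
    by (auto simp: elts_def)
  then show ?thesis
    by (auto simp: small_def)
qed

text \<open>Kuratowski's argument: \<open>vset\<close> is injective on small collections, so the
  equation becomes one between HOL doubletons.\<close>

lemma pair_eq_iff [simp]: "pair a b = pair c d \<longleftrightarrow> a = c \<and> b = d"
proof
  assume "pair a b = pair c d"
  then have "elts (vset {vset {a}, vset {a, b}}) = elts (vset {vset {c}, vset {c, d}})"
    by (simp add: pair_def)
  then have *: "{vset {a}, vset {a, b}} = {vset {c}, vset {c, d}}"
    by simp
  have inj: "vset X = vset Y \<longleftrightarrow> X = Y" if "small X" "small Y" for X Y :: "'a set"
    using that elts_vset by metis
  show "a = c \<and> b = d"
    using * by (auto simp: doubleton_eq_iff inj)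
qed simp

lemma small_pairs:
  assumes "small X" "small Y"
  shows "small ((\<lambda>(x, y). pair x y) ` (X \<times> Y))"
proof -
  have "small (\<Union>x\<in>X. pair x ` Y)"
    by (intro small_UN small_image assms)
  moreover have "(\<Union>x\<in>X. pair x ` Y) = (\<lambda>(x, y). pair x y) ` (X \<times> Y)"
    by auto
  ultimately show ?thesis
    by simp
qed

section \<open>Foundation and transitive closures\<close>

lemma vmem_wf: "wfP (\<in>\<^sub>V)"
  using foundation by (simp add: wfp_def)

lemma vmem_induct [case_names vmem]:
  assumes "\<And>x. (\<And>y. y \<in>\<^sub>V x \<Longrightarrow> Pr y) \<Longrightarrow> Pr x"
  shows "Pr x"
  using wfp_induct_rule[OF vmem_wf, of Pr] assms by blast

lemma vmem_irrefl [simp]: "\<not> x \<in>\<^sub>V x"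
  using wf_not_refl[OF foundation] by blast

lemma vmem_asym: "x \<in>\<^sub>V y \<Longrightarrow> \<not> y \<in>\<^sub>V x"
  using wf_not_sym[OF foundation] by blast

lemma tc_eq: "tc x = elts x \<union> (\<Union>y\<in>elts x. tc y)"
proof -
  have "vmem\<^sup>+\<^sup>+ z x \<longleftrightarrow> z \<in>\<^sub>V x \<or> (\<exists>y. y \<in>\<^sub>V x \<and> vmem\<^sup>+\<^sup>+ z y)" for z
    by (subst tranclp.simps) blast
  then show ?thesis
    by (auto simp: tc_def)
qed

lemma small_tc [simp]: "small (tc x)"
proof (induction x rule: vmem_induct)
  case (vmem x)
  then show ?case
    by (subst tc_eq) (intro small_Un small_UN; simp)
qed

section \<open>The von Neumann natural numbers\<close>

primrec vnat :: "nat \<Rightarrow> 'v::zfc" where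
  "vnat 0 = vset {}"
| "vnat (Suc n) = vset (insert (vnat n) (elts (vnat n)))"

lemma elts_vnat: "elts (vnat n :: 'v::zfc) = vnat ` {..<n}"
proof (induction n)
  case (Suc n)
  have "elts (vnat (Suc n) :: 'v) = insert (vnat n) (elts (vnat n))"
    by simp
  then show ?case
    by (simp only: Suc.IH lessThan_Suc image_insert)
qed simp

lemma inj_vnat: "inj (vnat :: nat \<Rightarrow> 'v::zfc)"
proof (rule linorder_injI)
  fix m n :: nat
  assume "m < n"
  then have "(vnat m :: 'v) \<in>\<^sub>V vnat n"
    unfolding mem_elts[symmetric] elts_vnat by blast
  then show "(vnat m :: 'v) \<noteq> vnat n"
    by auto
qed

lemma small_range_vnat: "small (range (vnat :: nat \<Rightarrow> 'v::zfc))"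
proof -
  obtain u :: 'v where u0: "\<exists>z. z \<in>\<^sub>V u \<and> (\<forall>w. \<not> w \<in>\<^sub>V z)"
    and uS: "\<forall>y. y \<in>\<^sub>V u \<longrightarrow> (\<exists>s. s \<in>\<^sub>V u \<and> (\<forall>z. z \<in>\<^sub>V s \<longleftrightarrow> z \<in>\<^sub>V y \<or> z = y))"
    using infinity by blast
  have "vnat n \<in>\<^sub>V u" for n
  proof (induction n)
    case 0
    obtain z where z: "z \<in>\<^sub>V u" "\<forall>w. \<not> w \<in>\<^sub>V z"
      using u0 by blast
    then have "z = vnat 0"
      by (intro extensionality) simp
    then show ?case
      using z by simp
  next
    case (Suc n)
    then obtain s where s: "s \<in>\<^sub>V u" "\<forall>z. z \<in>\<^sub>V s \<longleftrightarrow> z \<in>\<^sub>V vnat n \<or> z = vnat n"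
      using uS by blast
    then have "s = vnat (Suc n)"
      by (intro extensionality) auto
    then show ?case
      using s(1) by (simp only:)
  qed
  then show ?thesis
    by (intro small_subset[OF small_elts[of u]]) auto
qed

text \<open>A countable collection is the image of a set of numerals under a HOL function, and
  replacement holds for arbitrary HOL functions.\<close>

lemma small_countable:
  fixes X :: "'v::zfc set"
  assumes "countable X"
  shows "small X"
proof -
  have "X = (\<lambda>w. from_nat_into X (inv vnat w)) ` (vnat ` to_nat_on X ` X)"
    using assms by (auto simp: image_image inj_vnat inv_f_f)
  moreover have "small (vnat ` to_nat_on X ` X)"
    by (rule small_subset[OF small_range_vnat]) auto
  ultimately show ?thesis
    using small_image by metis
qed

section \<open>Ordinals\<close>

lemma ordinal_mem: "ordinal \<alpha> \<Longrightarrow> \<beta> \<in>\<^sub>V \<alpha> \<Longrightarrow> ordinal \<beta>"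
  unfolding ordinal_def transitive_set_def mem_elts[symmetric] by blast

lemma ordinal_trans: "ordinal \<alpha> \<Longrightarrow> \<beta> \<in>\<^sub>V \<alpha> \<Longrightarrow> \<gamma> \<in>\<^sub>V \<beta> \<Longrightarrow> \<gamma> \<in>\<^sub>V \<alpha>"
  unfolding ordinal_def transitive_set_def mem_elts[symmetric] by blast

text \<open>Nested induction on membership: if the ordinals differ and neither belongs to the other,
  the two induction hypotheses make every element of each an element of the other, against
  extensionality.\<close>

lemma ordinal_linear: "ordinal \<alpha> \<Longrightarrow> ordinal \<beta> \<Longrightarrow> \<alpha> \<in>\<^sub>V \<beta> \<or> \<alpha> = \<beta> \<or> \<beta> \<in>\<^sub>V \<alpha>"
proof (induction \<alpha> arbitrary: \<beta> rule: vmem_induct)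
  case (vmem \<alpha>)
  note IH1 = vmem.IH and \<alpha> = vmem.prems(1)
  from vmem.prems(2) show ?case
  proof (induction \<beta> rule: vmem_induct)
    case (vmem \<beta>)
    show ?case
    proof (rule ccontr)
      assume neg: "\<not> ?thesis"
      have "\<gamma> \<in>\<^sub>V \<beta>" if "\<gamma> \<in>\<^sub>V \<alpha>" for \<gamma>
        using IH1[OF that ordinal_mem[OF \<alpha> that] vmem.prems] neg that
          ordinal_trans[OF \<alpha> that] by blast
      moreover have "\<gamma> \<in>\<^sub>V \<alpha>" if "\<gamma> \<in>\<^sub>V \<beta>" for \<gamma>
        using vmem.IH[OF that ordinal_mem[OF vmem.prems that]] neg that
          ordinal_trans[OF vmem.prems that] by blast
      ultimately have "\<alpha> = \<beta>"
        by (intro extensionality) blast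
      then show False
        using neg by blast
    qed
  qed
qed

text \<open>Such an isomorphism is the identity, by induction on membership.\<close>

lemma ordinal_iso_eq:
  assumes "ordinal \<alpha>" "ordinal \<beta>" and h: "bij_betw h (elts \<alpha>) (elts \<beta>)"
    and mono: "\<And>x y. x \<in>\<^sub>V \<alpha> \<Longrightarrow> y \<in>\<^sub>V \<alpha> \<Longrightarrow> h x \<in>\<^sub>V h y \<longleftrightarrow> x \<in>\<^sub>V y"
  shows "\<alpha> = \<beta>"
proof -
  have "x \<in>\<^sub>V \<alpha> \<longrightarrow> h x = x" for x
  proof (induction x rule: vmem_induct)
    case (vmem x)
    show ?case
    proof
      assume x: "x \<in>\<^sub>V \<alpha>"
      then have "h x \<in>\<^sub>V \<beta>"
        using h by (auto simp: bij_betw_def)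
      have "z \<in>\<^sub>V h x \<longleftrightarrow> z \<in>\<^sub>V x" for z
      proof
        assume z: "z \<in>\<^sub>V h x"
        then have "z \<in>\<^sub>V \<beta>"
          using ordinal_trans[OF assms(2) \<open>h x \<in>\<^sub>V \<beta>\<close>] by blast
        then obtain y where "y \<in>\<^sub>V \<alpha>" "z = h y"
          using h by (metis bij_betw_def imageE mem_elts)
        then show "z \<in>\<^sub>V x"
          using vmem.IH mono[of y x] x z by metis
      next
        assume z: "z \<in>\<^sub>V x"
        then have "z \<in>\<^sub>V \<alpha>"
          using ordinal_trans[OF assms(1) x] by blast
        then show "z \<in>\<^sub>V h x"
          using vmem.IH mono[of z x] x z by metis
      qed
      then show "h x = x"
        by (intro extensionality) blast
    qed
  qed
  then have "h ` elts \<alpha> = elts \<alpha>"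
    by (auto simp: image_def)
  then show ?thesis
    using h by (simp add: bij_betw_def)
qed

text \<open>Hartogs' argument: an injection of \<alpha> into \<open>x\<close> carries the membership
  order to a relation on \<open>x\<close>, and this relation determines \<alpha>. So the ordinals in
  question are decoded from subsets of a product of \<open>x\<close> with itself, and these form a
  set.\<close>

lemma small_ordinals_lepoll:
  fixes x :: "'v::zfc"
  shows "small {\<alpha> :: 'v. ordinal \<alpha> \<and> elts \<alpha> \<lesssim> elts x}"
proof -
  \<comment> \<open>The reflexive order is transported, not the strict one: the diagonal then
    records the range of \<open>f\<close>, and the codes of 0 and 1 differ.\<close>
  define code where "code \<alpha> f = vset ((\<lambda>(a, b). pair (f a) (f b)) `
      {(a, b). a \<in>\<^sub>V \<alpha> \<and> b \<in>\<^sub>V \<alpha> \<and> (a \<in>\<^sub>V b \<or> a = b)})" for \<alpha> :: 'v and f :: "'v \<Rightarrow> 'v"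
  define inj where "inj \<alpha> f \<longleftrightarrow> ordinal \<alpha> \<and> inj_on f (elts \<alpha>) \<and> f ` elts \<alpha> \<subseteq> elts x"
    for \<alpha> :: 'v and f :: "'v \<Rightarrow> 'v"
  define X where "X = (\<lambda>(a, b). pair a b) ` (elts x \<times> elts x)"
  have "small X"
    unfolding X_def by (intro small_pairs small_elts)
  have sub: "(\<lambda>(a, b). pair (f a) (f b)) `
      {(a, b). a \<in>\<^sub>V \<alpha> \<and> b \<in>\<^sub>V \<alpha> \<and> (a \<in>\<^sub>V b \<or> a = b)} \<subseteq> X" if "inj \<alpha> f" for \<alpha> f
    using that by (fastforce simp: inj_def X_def)
  have elts_code: "pair u v \<in>\<^sub>V code \<alpha> f \<longleftrightarrow>
      (\<exists>a b. u = f a \<and> v = f b \<and> a \<in>\<^sub>V \<alpha> \<and> b \<in>\<^sub>V \<alpha> \<and> (a \<in>\<^sub>V b \<or> a = b))" if "inj \<alpha> f" for \<alpha> f u v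
    using small_subset[OF \<open>small X\<close> sub[OF that]] by (simp add: code_def image_iff) metis
  have unique: "\<alpha> = \<beta>" if f: "inj \<alpha> f" and g: "inj \<beta> g" and eq: "code \<alpha> f = code \<beta> g"
    for \<alpha> \<beta> f g
  proof -
    have iff: "(\<exists>a b. u = f a \<and> v = f b \<and> a \<in>\<^sub>V \<alpha> \<and> b \<in>\<^sub>V \<alpha> \<and> (a \<in>\<^sub>V b \<or> a = b)) \<longleftrightarrow>
      (\<exists>a b. u = g a \<and> v = g b \<and> a \<in>\<^sub>V \<beta> \<and> b \<in>\<^sub>V \<beta> \<and> (a \<in>\<^sub>V b \<or> a = b))" for u v
      unfolding elts_code[OF f, symmetric] elts_code[OF g, symmetric] eq ..
    have injf: "inj_on f (elts \<alpha>)" and injg: "inj_on g (elts \<beta>)"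
      using f g by (auto simp: inj_def)
    \<comment> \<open>Membership in the range is read off the diagonal of the common code.\<close>
    have "u \<in> f ` elts \<alpha> \<longleftrightarrow> u \<in> g ` elts \<beta>" for u
      using iff[of u u] unfolding image_iff mem_elts Bex_def by metis
    then have img: "f ` elts \<alpha> = g ` elts \<beta>"
      by blast
    \<comment> \<open>Both injections have the same range, so going through it matches \<alpha> with
      \<beta>.\<close>
    define h where "h = the_inv_into (elts \<beta>) g \<circ> f"
    have bij: "bij_betw h (elts \<alpha>) (elts \<beta>)"
      unfolding h_def using injf injg img
      by (intro bij_betw_trans[of f _ "f ` elts \<alpha>"])
        (auto simp: bij_betw_def inj_on_the_inv_into the_inv_into_onto)
    have gh: "g (h a) = f a" if "a \<in>\<^sub>V \<alpha>" for a
      unfolding h_def using f_the_inv_into_f[OF injg] img that by (metis comp_apply imageI mem_elts)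
    show ?thesis
    proof (rule ordinal_iso_eq[OF _ _ bij])
      fix a b
      assume ab: "a \<in>\<^sub>V \<alpha>" "b \<in>\<^sub>V \<alpha>"
      then have hab: "h a \<in>\<^sub>V \<beta>" "h b \<in>\<^sub>V \<beta>"
        using bij by (auto simp: bij_betw_def)
      have "a \<in>\<^sub>V b \<or> a = b \<longleftrightarrow> h a \<in>\<^sub>V h b \<or> h a = h b"
      proof
        assume "a \<in>\<^sub>V b \<or> a = b"
        then obtain a' b' where "f a = g a'" "f b = g b'" "a' \<in>\<^sub>V \<beta>" "b' \<in>\<^sub>V \<beta>" "a' \<in>\<^sub>V b' \<or> a' = b'"
          using iff[of "f a" "f b"] ab by blast
        then show "h a \<in>\<^sub>V h b \<or> h a = h b"
          using injg hab gh ab by (metis inj_onD mem_elts)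
      next
        assume "h a \<in>\<^sub>V h b \<or> h a = h b"
        then obtain a' b' where "f a = f a'" "f b = f b'" "a' \<in>\<^sub>V \<alpha>" "b' \<in>\<^sub>V \<alpha>" "a' \<in>\<^sub>V b' \<or> a' = b'"
          using iff[of "g (h a)" "g (h b)"] hab gh ab by metis
        then show "a \<in>\<^sub>V b \<or> a = b"
          using injf ab by (metis inj_onD mem_elts)
      qed
      moreover have "a = b \<longleftrightarrow> h a = h b"
        using bij ab by (auto simp: bij_betw_def inj_on_def)
      ultimately show "h a \<in>\<^sub>V h b \<longleftrightarrow> a \<in>\<^sub>V b"
        by auto
    qed (use f g in \<open>auto simp: inj_def\<close>)
  qed
  \<comment> \<open>By \<open>unique\<close> a code has only one decoding, so the description below
    picks out \<alpha>.\<close>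
  have "{\<alpha> :: 'v. ordinal \<alpha> \<and> elts \<alpha> \<lesssim> elts x} \<subseteq>
    (\<lambda>w. THE \<alpha>. \<exists>f. inj \<alpha> f \<and> w = code \<alpha> f) ` {w. elts w \<subseteq> elts (vset X)}"
  proof
    fix \<alpha> :: 'v
    assume "\<alpha> \<in> {\<alpha>. ordinal \<alpha> \<and> elts \<alpha> \<lesssim> elts x}"
    then obtain f where f: "inj \<alpha> f"
      by (auto simp: lepoll_def inj_def)
    have "(THE \<beta>. \<exists>g. inj \<beta> g \<and> code \<alpha> f = code \<beta> g) = \<alpha>"
      using f unique[OF f] by (intro the_equality) metis+
    moreover have "elts (code \<alpha> f) \<subseteq> elts (vset X)"
      unfolding code_def using small_subset[OF \<open>small X\<close> sub[OF f]] sub[OF f] \<open>small X\<close> by simp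
    ultimately show "\<alpha> \<in> (\<lambda>w. THE \<alpha>. \<exists>f. inj \<alpha> f \<and> w = code \<alpha> f) ` {w. elts w \<subseteq> elts (vset X)}"
      by (intro image_eqI[where x = "code \<alpha> f"]) auto
  qed
  then show ?thesis
    by (rule small_subset[OF small_image[OF small_Pow]])
qed

section \<open>Comparing cardinals, and regular cardinals above a given set\<close>

unbundle cardinal_syntax

lemma lepoll_iff_card_of: "A \<lesssim> B \<longleftrightarrow> |A| \<le>o |B|"
  unfolding lepoll_def card_of_ordLeq[symmetric] by blast

text \<open>Any two cardinals are comparable because well-orders are, and Schroeder-Bernstein turns
  mutual embeddings into a bijection.\<close>

lemma lesspoll_iff_not_lepoll: "A \<prec> B \<longleftrightarrow> \<not> B \<lesssim> A"
  using ordLeq_total[OF card_of_Well_order card_of_Well_order, of A B] lepoll_antisym eqpoll_imp_lepoll eqpoll_sym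
  unfolding lesspoll_def lepoll_iff_card_of[symmetric] by blast

text \<open>The successor cardinal of \<open>x\<close> is realised as its Hartogs number.\<close>

lemma ex_regular_cardinal:
  fixes x :: "'v::zfc"
  assumes inf: "infinite (elts x)"
  obtains \<theta> :: 'v where "regular_cardinal \<theta>" "elts x \<prec> elts \<theta>"
    "\<And>\<alpha> :: 'v. ordinal \<alpha> \<Longrightarrow> elts \<alpha> \<lesssim> elts x \<Longrightarrow> \<alpha> \<in>\<^sub>V \<theta>"
proof
  define \<theta> :: 'v where "\<theta> = vset {\<alpha>. ordinal \<alpha> \<and> elts \<alpha> \<lesssim> elts x}"
  have mem: "\<alpha> \<in>\<^sub>V \<theta> \<longleftrightarrow> ordinal \<alpha> \<and> elts \<alpha> \<lesssim> elts x" for \<alpha>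
    by (simp add: \<theta>_def small_ordinals_lepoll)
  show "\<And>\<alpha> :: 'v. ordinal \<alpha> \<Longrightarrow> elts \<alpha> \<lesssim> elts x \<Longrightarrow> \<alpha> \<in>\<^sub>V \<theta>"
    by (simp add: mem)
  have "elts \<beta> \<subseteq> elts \<theta>" if "\<beta> \<in>\<^sub>V \<theta>" for \<beta>
  proof
    fix \<gamma>
    assume "\<gamma> \<in> elts \<beta>"
    moreover from this have "elts \<gamma> \<subseteq> elts \<beta>"
      using that mem by (auto simp: ordinal_def transitive_set_def)
    ultimately show "\<gamma> \<in> elts \<theta>"
      using that mem ordinal_mem lepoll_trans[OF subset_imp_lepoll] by auto
  qed
  then have ord: "ordinal \<theta>"
    using mem by (auto simp: ordinal_def transitive_set_def)
  \<comment> \<open>Otherwise \<theta> would satisfy its own membership condition and belong to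
    itself.\<close>
  show less: "elts x \<prec> elts \<theta>"
    using mem[of \<theta>] ord by (auto simp: lesspoll_iff_not_lepoll)
  have "infinite (elts \<theta>)"
    using less inf by (metis finite_lepoll_infinite lesspoll_iff_not_lepoll)
  moreover have "\<forall>\<alpha>\<in>elts \<theta>. elts \<alpha> \<prec> elts \<theta>"
    using mem less lesspoll_trans1 by auto
  moreover have "\<exists>\<beta>\<in>elts \<theta>. S \<subseteq> elts \<beta>" if S: "S \<subseteq> elts \<theta>" "S \<prec> elts \<theta>" for S
  proof -
    \<comment> \<open>Regularity: in the well-order of \<theta> by membership, \<open>|S|\<close> is
      isomorphic to the segment below some \<alpha> in \<theta>, hence no larger than
      \<open>x\<close>.\<close>
    define r where "r = {(\<alpha>, \<beta>). \<alpha> \<in>\<^sub>V \<theta> \<and> \<beta> \<in>\<^sub>V \<theta> \<and> (\<alpha> \<in>\<^sub>V \<beta> \<or> \<alpha> = \<beta>)}"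
    have Field: "Field r = elts \<theta>"
      by (auto simp: r_def Field_def)
    have "well_order_on (elts \<theta>) r"
      unfolding well_order_on_def linear_order_on_def partial_order_on_def preorder_on_def
    proof (intro conjI)
      show "trans r"
        unfolding trans_def r_def using ordinal_trans mem by blast
      show "antisym r"
        unfolding antisym_def r_def using vmem_asym by blast
      show "total_on (elts \<theta>) r"
        unfolding total_on_def r_def using ordinal_linear mem
        by (metis (mono_tags, lifting) case_prodI mem_Collect_eq mem_elts)
      show "wf (r - Id)"
        by (rule wf_subset[OF foundation]) (auto simp: r_def)
    qed (auto simp: refl_on_def r_def)
    then have wo: "Well_order r" "well_order_on (elts \<theta>) r"
      by (simp_all add: Field)
    have "|S| <o |elts \<theta>|"
      using S(2) not_ordLeq_iff_ordLess[OF card_of_Well_order card_of_Well_order]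
      unfolding lesspoll_iff_not_lepoll lepoll_iff_card_of by blast
    then have "|S| <o r"
      using card_of_least[OF wo(2)] ordLess_ordLeq_trans by blast
    then obtain \<alpha> where \<alpha>: "\<alpha> \<in>\<^sub>V \<theta>" "|S| =o Restr r (underS r \<alpha>)"
      using ordLess_iff_ordIso_Restr[OF wo(1) card_of_Well_order] Field by (metis mem_elts)
    have "underS r \<alpha> = elts \<alpha>"
      using \<alpha>(1) ord by (auto simp: underS_def r_def intro: ordinal_trans)
    moreover have "underS r \<alpha> \<subseteq> Field r"
      using underS_Field by fast
    moreover have "Refl r"
      using wo(1) by (simp add: order_on_defs)
    ultimately have "Field (Restr r (underS r \<alpha>)) = elts \<alpha>"
      using Refl_Field_Restr2[of r "underS r \<alpha>"] by simp
    then have "|S| \<le>o |elts x|"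
      using card_of_cong[OF \<alpha>(2)] \<alpha>(1) mem
      by (metis Field_card_of lepoll_iff_card_of ordIso_ordLeq_trans)
    moreover have "\<forall>\<alpha>\<in>S. |elts \<alpha>| \<le>o |elts x|"
      using S(1) mem by (auto simp: lepoll_iff_card_of)
    ultimately have "|\<Union>\<alpha>\<in>S. elts \<alpha>| \<le>o |elts x|" "|S| \<le>o |elts x|"
      using card_of_UNION_ordLeq_infinite[OF inf] by blast+
    \<comment> \<open>The bound for \<open>S\<close> is the ordinal formed by \<open>S\<close>
      together with its union; the union alone would omit a largest element of
      \<open>S\<close>.\<close>
    then have "|S \<union> (\<Union>\<alpha>\<in>S. elts \<alpha>)| \<le>o |elts x|"
      using card_of_Un_ordLeq_infinite_Field[OF _ _ _ card_of_Card_order] inf by (metis Field_card_of)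
    moreover have smallS: "small S" "small (S \<union> (\<Union>\<alpha>\<in>S. elts \<alpha>))"
      using small_subset[OF small_elts S(1)] by (simp_all add: small_UN)
    have ordS: "\<And>\<alpha>. \<alpha> \<in> S \<Longrightarrow> ordinal \<alpha>"
      using S(1) mem by auto
    moreover have "ordinal (vset (S \<union> (\<Union>\<alpha>\<in>S. elts \<alpha>)))"
      unfolding ordinal_def
    proof
      show "transitive_set (vset (S \<union> (\<Union>\<alpha>\<in>S. elts \<alpha>)))"
        unfolding transitive_set_def elts_vset[OF smallS(2)] using ordinal_trans[OF ordS]
        by (auto; blast)
      show "\<forall>y\<in>elts (vset (S \<union> (\<Union>\<alpha>\<in>S. elts \<alpha>))). transitive_set y"
        unfolding elts_vset[OF smallS(2)] using ordS ordinal_mem by (auto simp: ordinal_def)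
    qed
    ultimately have "vset (S \<union> (\<Union>\<alpha>\<in>S. elts \<alpha>)) \<in>\<^sub>V \<theta>"
      unfolding mem lepoll_iff_card_of elts_vset[OF smallS(2)] by blast
    then show ?thesis
      using smallS by (intro bexI[where x = "vset (S \<union> (\<Union>\<alpha>\<in>S. elts \<alpha>))"]) auto
  qed
  ultimately show "regular_cardinal \<theta>"
    using ord unfolding regular_cardinal_def by blast
qed

section \<open>The forcing relation\<close>

declare forces.simps(5) [simp del]

lemma is_name_iff:
  "is_name P \<tau> \<longleftrightarrow> (\<forall>w \<in> elts \<tau>. \<exists>\<sigma> s. w = pair \<sigma> s \<and> is_name P \<sigma> \<and> s \<in> elts P)"
  by (subst is_name.simps) blast

lemma name_component: "is_name P \<tau> \<Longrightarrow> pair \<sigma> s \<in>\<^sub>V \<tau> \<Longrightarrow> is_name P \<sigma> \<and> s \<in>\<^sub>V P"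
  unfolding is_name_iff[of P \<tau>] by (metis mem_elts pair_eq_iff)

text \<open>A component \<sigma> is reached from \<tau> by descending through the pair and the
  singleton of \<sigma>. The resulting induction over components applies to arbitrary sets, not only
  to names.\<close>

lemma wfP_name: "wfP (\<lambda>\<sigma> \<tau>. \<exists>s. pair \<sigma> s \<in>\<^sub>V \<tau>)"
proof -
  have "(\<in>\<^sub>V)\<^sup>+\<^sup>+ \<sigma> \<tau>" if "pair \<sigma> s \<in>\<^sub>V \<tau>" for \<sigma> \<tau> s :: 'a
  proof -
    have "\<sigma> \<in>\<^sub>V vset {\<sigma>}" "vset {\<sigma>} \<in>\<^sub>V pair \<sigma> s"
      by (simp_all add: pair_def small_upair)
    then show ?thesis
      using that by (meson tranclp.intros)
  qed
  then show ?thesis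
    by (intro wfp_subset[OF wfp_tranclp[OF vmem_wf]]) auto
qed

lemma name_induct [case_names name]:
  assumes "\<And>\<tau>. (\<And>\<sigma> s. pair \<sigma> s \<in>\<^sub>V \<tau> \<Longrightarrow> Pr \<sigma>) \<Longrightarrow> Pr \<tau>"
  shows "Pr \<tau>"
  using wfp_induct_rule[OF wfP_name, of Pr] assms by blast

locale forcing_notion =
  fixes P R :: "'v::zfc"
  assumes forcing: "forcing P R"
begin

abbreviation below (infix \<open>\<preceq>\<close> 50) where "p \<preceq> q \<equiv> le R p q"
abbreviation feq (\<open>_ \<tturnstile> _ \<approx> _\<close> [51, 51, 51] 50) where "p \<tturnstile> a \<approx> b \<equiv> forces_eq R p a b"
abbreviation fmem (\<open>_ \<tturnstile> _ \<epsilon> _\<close> [51, 51, 51] 50) where "p \<tturnstile> a \<epsilon> b \<equiv> forces_mem R p a b"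
abbreviation name where "name \<equiv> is_name P"

text \<open>For \<open>p\<close> outside \<open>P\<close> nothing lies below \<open>p\<close> and
  the condition is vacuous, which lets many lemmas be stated for arbitrary \<open>p\<close>.\<close>

definition dense_below :: "'v \<Rightarrow> ('v \<Rightarrow> bool) \<Rightarrow> bool" where
  "dense_below p X \<longleftrightarrow> (\<forall>q. q \<preceq> p \<longrightarrow> (\<exists>r. r \<preceq> q \<and> X r))"

lemma le_carrier: "p \<preceq> q \<Longrightarrow> p \<in>\<^sub>V P \<and> q \<in>\<^sub>V P"
proof -
  assume "p \<preceq> q"
  moreover have "elts R \<subseteq> (\<lambda>(p, q). pair p q) ` (elts P \<times> elts P)"
    using forcing by (simp add: forcing_def)
  ultimately have "pair p q \<in> (\<lambda>(p, q). pair p q) ` (elts P \<times> elts P)"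
    unfolding le_def mem_elts[symmetric] by (rule rev_subsetD)
  then show "p \<in>\<^sub>V P \<and> q \<in>\<^sub>V P"
    by auto
qed

lemma le_refl: "p \<in>\<^sub>V P \<Longrightarrow> p \<preceq> p"
  using forcing by (auto simp: forcing_def)

lemma le_refl': "q \<preceq> p \<Longrightarrow> q \<preceq> q"
  using le_carrier le_refl by blast

lemma le_trans: "p \<preceq> q \<Longrightarrow> q \<preceq> r \<Longrightarrow> p \<preceq> r"
  using forcing le_carrier[of p q] le_carrier[of q r] unfolding forcing_def mem_elts[symmetric] by blast

lemma dense_belowI: "(\<And>q. q \<preceq> p \<Longrightarrow> \<exists>r. r \<preceq> q \<and> X r) \<Longrightarrow> dense_below p X"
  by (simp add: dense_below_def)

lemma dense_belowD: "dense_below p X \<Longrightarrow> q \<preceq> p \<Longrightarrow> \<exists>r. r \<preceq> q \<and> X r"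
  by (simp add: dense_below_def)

lemma dense_below_all: "(\<And>q. q \<preceq> p \<Longrightarrow> X q) \<Longrightarrow> dense_below p X"
  unfolding dense_below_def using le_refl' by blast

lemma dense_below_le: "dense_below p X \<Longrightarrow> q \<preceq> p \<Longrightarrow> dense_below q X"
  unfolding dense_below_def using le_trans by blast

text \<open>Refinements compose: go down to a point of \<open>X\<close>, then further down to a
  point of \<open>Y\<close>.\<close>

lemma dense_below_mono:
  "dense_below p X \<Longrightarrow> (\<And>q. q \<preceq> p \<Longrightarrow> X q \<Longrightarrow> dense_below q Y) \<Longrightarrow> dense_below p Y"
  unfolding dense_below_def by (meson le_trans le_refl')

section \<open>Monotonicity and density for the forcing relation\<close>

lemma forces_mem_iff:
  "p \<tturnstile> a \<epsilon> b \<longleftrightarrow> dense_below p (\<lambda>r. \<exists>\<sigma> s. pair \<sigma> s \<in>\<^sub>V b \<and> r \<preceq> s \<and> r \<tturnstile> a \<approx> \<sigma>)"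
  unfolding dense_below_def by (subst forces_mem.simps) blast

lemma forces_eq_iff:
  "p \<tturnstile> a \<approx> b \<longleftrightarrow>
    (\<forall>\<sigma> s q. pair \<sigma> s \<in>\<^sub>V a \<and> q \<preceq> p \<and> q \<preceq> s \<longrightarrow> q \<tturnstile> \<sigma> \<epsilon> b) \<and>
    (\<forall>\<sigma> s q. pair \<sigma> s \<in>\<^sub>V b \<and> q \<preceq> p \<and> q \<preceq> s \<longrightarrow> q \<tturnstile> \<sigma> \<epsilon> a)"
  by (subst forces_eq.simps) blast

lemma forces_mem_mono: "p \<tturnstile> a \<epsilon> b \<Longrightarrow> q \<preceq> p \<Longrightarrow> q \<tturnstile> a \<epsilon> b"
  unfolding forces_mem_iff by (rule dense_below_le)

lemma forces_eq_mono: "p \<tturnstile> a \<approx> b \<Longrightarrow> q \<preceq> p \<Longrightarrow> q \<tturnstile> a \<approx> b"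
  unfolding forces_eq_iff[of p] forces_eq_iff[of q] using le_trans by blast

lemma forces_mono: "forces P R p \<phi> e \<Longrightarrow> q \<preceq> p \<Longrightarrow> forces P R q \<phi> e"
proof (induction \<phi> arbitrary: e p q)
  case (Neg \<phi>)
  then show ?case
    using le_trans by auto
qed (auto intro: forces_mem_mono forces_eq_mono simp: forces.simps(5))

lemma dense_forces_mem:
  assumes "dense_below p (\<lambda>r. r \<tturnstile> a \<epsilon> b)"
  shows "p \<tturnstile> a \<epsilon> b"
  using assms unfolding forces_mem_iff by (rule dense_below_mono)

lemma forces_memI:
  assumes "pair \<sigma> s \<in>\<^sub>V b" "p \<preceq> s" "p \<tturnstile> a \<approx> \<sigma>"
  shows "p \<tturnstile> a \<epsilon> b"
  unfolding forces_mem_iff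
proof (rule dense_below_all)
  fix q
  assume "q \<preceq> p"
  then show "\<exists>\<sigma> s. pair \<sigma> s \<in>\<^sub>V b \<and> q \<preceq> s \<and> q \<tturnstile> a \<approx> \<sigma>"
    using assms le_trans forces_eq_mono by blast
qed

text \<open>Membership in \<open>b\<close> is decided only densely; this rule lets a proof work at a
  condition where a component of \<open>b\<close> equal to \<open>a\<close> has already been
  chosen.\<close>

lemma forces_mem_reduce:
  assumes "p \<tturnstile> a \<epsilon> b"
    and "\<And>r \<sigma> s. r \<preceq> p \<Longrightarrow> pair \<sigma> s \<in>\<^sub>V b \<Longrightarrow> r \<preceq> s \<Longrightarrow> r \<tturnstile> a \<approx> \<sigma> \<Longrightarrow> r \<tturnstile> c \<epsilon> d"
  shows "p \<tturnstile> c \<epsilon> d"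
proof (rule dense_forces_mem, rule dense_belowI)
  fix q
  assume q: "q \<preceq> p"
  then obtain r \<sigma> s where "r \<preceq> q" "pair \<sigma> s \<in>\<^sub>V b" "r \<preceq> s" "r \<tturnstile> a \<approx> \<sigma>"
    using assms(1) unfolding forces_mem_iff dense_below_def by blast
  then show "\<exists>r. r \<preceq> q \<and> r \<tturnstile> c \<epsilon> d"
    using assms(2) le_trans[OF _ q] by blast
qed

lemma dense_forces_eq:
  assumes "dense_below p (\<lambda>r. r \<tturnstile> a \<approx> b)"
  shows "p \<tturnstile> a \<approx> b"
  unfolding forces_eq_iff
proof (intro conjI allI impI; elim conjE)
  fix \<sigma> s q
  assume s: "q \<preceq> p" "q \<preceq> s"
  { assume "pair \<sigma> s \<in>\<^sub>V a"
    then have "dense_below q (\<lambda>r. r \<tturnstile> \<sigma> \<epsilon> b)"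
      using dense_below_le[OF assms s(1)] s(2) le_trans le_refl'
      unfolding dense_below_def forces_eq_iff by meson
    then show "q \<tturnstile> \<sigma> \<epsilon> b"
      by (rule dense_forces_mem) }
  { assume "pair \<sigma> s \<in>\<^sub>V b"
    then have "dense_below q (\<lambda>r. r \<tturnstile> \<sigma> \<epsilon> a)"
      using dense_below_le[OF assms s(1)] s(2) le_trans le_refl'
      unfolding dense_below_def forces_eq_iff by meson
    then show "q \<tturnstile> \<sigma> \<epsilon> a"
      by (rule dense_forces_mem) }
qed

text \<open>Induction on the formula. For \<open>Neg\<close>, a condition forcing \<phi> would pass
  this on to its extensions, one of which forces \<open>Neg \<phi>\<close> by density.\<close>

lemma dense_forces: "dense_below p (\<lambda>r. forces P R r \<phi> e) \<Longrightarrow> forces P R p \<phi> e"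
proof (induction \<phi> arbitrary: e p)
  case (Mem i j)
  then show ?case
    by (auto intro: dense_forces_mem)
next
  case (Equal i j)
  then show ?case
    by (auto intro: dense_forces_eq)
next
  case (Neg \<phi>)
  show ?case
    unfolding forces.simps(3)
  proof (intro allI impI notI)
    fix q
    assume q: "q \<preceq> p" "forces P R q \<phi> e"
    obtain r where "r \<preceq> q" "forces P R r (Neg \<phi>) e"
      using dense_belowD[OF Neg.prems q(1)] by blast
    then show False
      using forces_mono[OF q(2)] le_refl' by auto
  qed
next
  case (Conj \<phi> \<psi>)
  then show ?case
    by (simp add: dense_below_def) meson
next
  case (All i \<phi>)
  show ?case
    unfolding forces.simps(5)
  proof (intro allI impI)
    fix \<tau>
    assume "name \<tau>"
    then have "dense_below p (\<lambda>r. forces P R r \<phi> (e(i := \<tau>)))"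
      using All.prems unfolding forces.simps(5) dense_below_def by blast
    then show "forces P R p \<phi> (e(i := \<tau>))"
      by (rule All.IH)
  qed
qed

subsection \<open>Connectives and bounded quantifiers\<close>

text \<open>\<open>Imp\<close> is built from \<open>Neg\<close> and \<open>Conj\<close>, so
  unfolding gives the conclusion only on a dense set; \<open>dense_forces\<close> makes it hold at
  \<open>q\<close> itself.\<close>

lemma forces_Imp:
  "forces P R p (Imp \<phi> \<psi>) e \<longleftrightarrow> (\<forall>q. q \<preceq> p \<longrightarrow> forces P R q \<phi> e \<longrightarrow> forces P R q \<psi> e)"
proof
  assume L: "forces P R p (Imp \<phi> \<psi>) e"
  show "\<forall>q. q \<preceq> p \<longrightarrow> forces P R q \<phi> e \<longrightarrow> forces P R q \<psi> e"
  proof (intro allI impI)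
    fix q
    assume q: "q \<preceq> p" "forces P R q \<phi> e"
    have "dense_below q (\<lambda>r. forces P R r \<psi> e)"
      using L forces_mono[OF q(2)] le_trans[OF _ q(1)] unfolding dense_below_def Imp_def by auto
    then show "forces P R q \<psi> e"
      by (rule dense_forces)
  qed
next
  assume "\<forall>q. q \<preceq> p \<longrightarrow> forces P R q \<phi> e \<longrightarrow> forces P R q \<psi> e"
  then show "forces P R p (Imp \<phi> \<psi>) e"
    unfolding Imp_def using le_refl' by auto
qed

lemma forces_Iff:
  "forces P R p (Iff \<phi> \<psi>) e \<longleftrightarrow> (\<forall>q. q \<preceq> p \<longrightarrow> (forces P R q \<phi> e \<longleftrightarrow> forces P R q \<psi> e))"
  by (auto simp: Iff_def forces_Imp)

lemma forces_Disj:
  "forces P R p (Disj \<phi> \<psi>) e \<longleftrightarrow> dense_below p (\<lambda>r. forces P R r \<phi> e \<or> forces P R r \<psi> e)"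
  unfolding Disj_def dense_below_def forces.simps by (meson forces_mono le_trans le_refl')

lemma forces_Ex:
  "forces P R p (Ex i \<phi>) e \<longleftrightarrow> dense_below p (\<lambda>r. \<exists>\<tau>. name \<tau> \<and> forces P R r \<phi> (e(i := \<tau>)))"
  unfolding Ex_def dense_below_def forces.simps by (meson forces_mono le_trans le_refl')

lemma forces_AllIn:
  "forces P R p (AllIn i j \<phi>) e \<longleftrightarrow> (\<forall>\<tau>. name \<tau> \<longrightarrow> (\<forall>q. q \<preceq> p \<longrightarrow>
     q \<tturnstile> \<tau> \<epsilon> (e(i := \<tau>)) j \<longrightarrow> forces P R q \<phi> (e(i := \<tau>))))"
  by (auto simp: AllIn_def forces.simps(5) forces_Imp)

lemma forces_ExIn:
  "forces P R p (ExIn i j \<phi>) e \<longleftrightarrow> dense_below p (\<lambda>r. \<exists>\<tau>. name \<tau> \<and>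
     r \<tturnstile> \<tau> \<epsilon> (e(i := \<tau>)) j \<and> forces P R r \<phi> (e(i := \<tau>)))"
  by (auto simp: ExIn_def forces_Ex)

subsection \<open>Equality\<close>

lemma forces_eq_refl: "p \<tturnstile> a \<approx> a"
proof (induction a arbitrary: p rule: name_induct)
  case (name a)
  have "q \<tturnstile> \<sigma> \<epsilon> a" if "pair \<sigma> s \<in>\<^sub>V a" "q \<preceq> s" for \<sigma> s q
    unfolding forces_mem_iff using that name le_trans by (intro dense_below_all) blast
  then show ?case
    unfolding forces_eq_iff by blast
qed

lemma forces_eq_sym: "p \<tturnstile> a \<approx> b \<Longrightarrow> p \<tturnstile> b \<approx> a"
  unfolding forces_eq_iff by blast

text \<open>Induction over the components of \<open>a\<close>, for all \<open>p\<close>,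
  \<open>b\<close> and \<open>c\<close> at once. Each inclusion follows an element through
  \<open>b\<close>, with one refinement per step.\<close>

lemma forces_eq_trans: "p \<tturnstile> a \<approx> b \<Longrightarrow> p \<tturnstile> b \<approx> c \<Longrightarrow> p \<tturnstile> a \<approx> c"
proof (induction a arbitrary: p b c rule: name_induct)
  case (name a)
  note ab = name.prems(1)[unfolded forces_eq_iff[of p]]
    and bc = name.prems(2)[unfolded forces_eq_iff[of p]]
  show ?case
    unfolding forces_eq_iff[of p a c]
  proof (intro conjI allI impI; elim conjE)
    fix \<sigma> s q
    assume q: "pair \<sigma> s \<in>\<^sub>V a" "q \<preceq> p" "q \<preceq> s"
    then have "q \<tturnstile> \<sigma> \<epsilon> b"
      using ab by blast
    then show "q \<tturnstile> \<sigma> \<epsilon> c"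
    proof (rule forces_mem_reduce)
      fix r \<sigma>' s'
      assume r: "r \<preceq> q" "pair \<sigma>' s' \<in>\<^sub>V b" "r \<preceq> s'" "r \<tturnstile> \<sigma> \<approx> \<sigma>'"
      then have "r \<tturnstile> \<sigma>' \<epsilon> c"
        using bc le_trans[OF r(1) q(2)] by blast
      then show "r \<tturnstile> \<sigma> \<epsilon> c"
      proof (rule forces_mem_reduce)
        fix t \<sigma>'' s''
        assume t: "t \<preceq> r" "pair \<sigma>'' s'' \<in>\<^sub>V c" "t \<preceq> s''" "t \<tturnstile> \<sigma>' \<approx> \<sigma>''"
        have "t \<tturnstile> \<sigma> \<approx> \<sigma>''"
          by (rule name.IH[OF q(1) forces_eq_mono[OF r(4) t(1)] t(4)])
        then show "t \<tturnstile> \<sigma> \<epsilon> c"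
          by (rule forces_memI[OF t(2,3)])
      qed
    qed
  next
    fix \<sigma> s q
    assume q: "pair \<sigma> s \<in>\<^sub>V c" "q \<preceq> p" "q \<preceq> s"
    then have "q \<tturnstile> \<sigma> \<epsilon> b"
      using bc by blast
    then show "q \<tturnstile> \<sigma> \<epsilon> a"
    proof (rule forces_mem_reduce)
      fix r \<sigma>' s'
      assume r: "r \<preceq> q" "pair \<sigma>' s' \<in>\<^sub>V b" "r \<preceq> s'" "r \<tturnstile> \<sigma> \<approx> \<sigma>'"
      then have "r \<tturnstile> \<sigma>' \<epsilon> a"
        using ab le_trans[OF r(1) q(2)] by blast
      then show "r \<tturnstile> \<sigma> \<epsilon> a"
      proof (rule forces_mem_reduce)
        fix t \<sigma>'' s''
        assume t: "t \<preceq> r" "pair \<sigma>'' s'' \<in>\<^sub>V a" "t \<preceq> s''" "t \<tturnstile> \<sigma>' \<approx> \<sigma>''"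
        \<comment> \<open>The induction hypothesis speaks only about components of \<open>a\<close>,
          so it is applied to \<open>\<sigma>''\<close> with both equalities reversed.\<close>
        have "t \<tturnstile> \<sigma>'' \<approx> \<sigma>"
          by (rule name.IH[OF t(2) forces_eq_sym[OF t(4)] forces_eq_sym[OF forces_eq_mono[OF r(4) t(1)]]])
        then show "t \<tturnstile> \<sigma> \<epsilon> a"
          by (rule forces_memI[OF t(2,3) forces_eq_sym])
      qed
    qed
  qed
qed

lemma forces_mem_cong:
  assumes "p \<tturnstile> a \<epsilon> b" "p \<tturnstile> a \<approx> a'" "p \<tturnstile> b \<approx> b'"
  shows "p \<tturnstile> a' \<epsilon> b'"
  using assms(1)
proof (rule forces_mem_reduce)
  fix r \<sigma> s
  assume r: "r \<preceq> p" "pair \<sigma> s \<in>\<^sub>V b" "r \<preceq> s" "r \<tturnstile> a \<approx> \<sigma>"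
  then have "r \<tturnstile> \<sigma> \<epsilon> b'"
    using assms(3)[unfolded forces_eq_iff[of p]] by blast
  moreover have eq: "r \<tturnstile> a' \<approx> \<sigma>"
    by (rule forces_eq_trans[OF forces_eq_sym[OF forces_eq_mono[OF assms(2) r(1)]] r(4)])
  ultimately show "r \<tturnstile> a' \<epsilon> b'"
    by (elim forces_mem_reduce) (rule forces_memI, assumption+, rule forces_eq_trans[OF forces_eq_mono])
qed

lemma forces_mem_pair: "pair \<sigma> s \<in>\<^sub>V a \<Longrightarrow> p \<preceq> s \<Longrightarrow> p \<tturnstile> \<sigma> \<epsilon> a"
  by (rule forces_memI[OF _ _ forces_eq_refl])

text \<open>Forward is congruence; backward, it suffices to test the components of the two names.
  This turns the element-wise formulas \<open>fm_upair\<close>, \<open>fm_pair\<close>,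
  \<open>fm_empty\<close> and \<open>fm_succ\<close> into equality with explicit names.\<close>

lemma forces_eq_extensional:
  assumes "name a" "name b"
  shows "p \<tturnstile> a \<approx> b \<longleftrightarrow>
    (\<forall>\<tau>. name \<tau> \<longrightarrow> (\<forall>q. q \<preceq> p \<longrightarrow> (q \<tturnstile> \<tau> \<epsilon> a \<longleftrightarrow> q \<tturnstile> \<tau> \<epsilon> b)))"
proof
  assume "p \<tturnstile> a \<approx> b"
  then show "\<forall>\<tau>. name \<tau> \<longrightarrow> (\<forall>q. q \<preceq> p \<longrightarrow> (q \<tturnstile> \<tau> \<epsilon> a \<longleftrightarrow> q \<tturnstile> \<tau> \<epsilon> b))"
    using forces_mem_cong forces_eq_mono forces_eq_refl forces_eq_sym by meson
next
  assume *: "\<forall>\<tau>. name \<tau> \<longrightarrow> (\<forall>q. q \<preceq> p \<longrightarrow> (q \<tturnstile> \<tau> \<epsilon> a \<longleftrightarrow> q \<tturnstile> \<tau> \<epsilon> b))"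
  then show "p \<tturnstile> a \<approx> b"
    unfolding forces_eq_iff using assms name_component forces_mem_pair by meson
qed

subsection \<open>Names for pairs and successors\<close>

text \<open>All conditions are attached, as in \<open>check\<close>, since \<open>P\<close> may lack
  a greatest one.\<close>

definition upn :: "'v \<Rightarrow> 'v \<Rightarrow> 'v" where
  "upn a b = vset ((\<lambda>(\<sigma>, s). pair \<sigma> s) ` ({a, b} \<times> elts P))"

text \<open>Kuratowski pairing of names, mirroring \<open>pair\<close> so that
  \<open>check_pair\<close> becomes an identity.\<close>

definition opn :: "'v \<Rightarrow> 'v \<Rightarrow> 'v" where
  "opn a b = upn (upn a a) (upn a b)"

definition sucn :: "'v \<Rightarrow> 'v" where
  "sucn a = vset (elts a \<union> (\<lambda>(\<sigma>, s). pair \<sigma> s) ` ({a} \<times> elts P))"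

lemma elts_upn: "elts (upn a b) = (\<lambda>(\<sigma>, s). pair \<sigma> s) ` ({a, b} \<times> elts P)"
  unfolding upn_def by (intro elts_vset small_pairs small_upair small_elts)

lemma elts_sucn: "elts (sucn a) = elts a \<union> (\<lambda>(\<sigma>, s). pair \<sigma> s) ` ({a} \<times> elts P)"
  unfolding sucn_def by (intro elts_vset small_Un small_pairs small_singleton small_elts)

lemma pair_mem_upn [simp]: "pair \<sigma> s \<in>\<^sub>V upn a b \<longleftrightarrow> (\<sigma> = a \<or> \<sigma> = b) \<and> s \<in>\<^sub>V P"
  using elts_upn[of a b] by (auto simp flip: mem_elts)

lemma pair_mem_sucn [simp]: "pair \<sigma> s \<in>\<^sub>V sucn a \<longleftrightarrow> pair \<sigma> s \<in>\<^sub>V a \<or> \<sigma> = a \<and> s \<in>\<^sub>V P"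
  using elts_sucn[of a] by (auto simp flip: mem_elts)

lemma name_upn [simp]: "name a \<Longrightarrow> name b \<Longrightarrow> name (upn a b)"
  by (subst is_name_iff) (auto simp: elts_upn)

lemma name_opn [simp]: "name a \<Longrightarrow> name b \<Longrightarrow> name (opn a b)"
  by (simp add: opn_def)

lemma name_sucn [simp]: "name a \<Longrightarrow> name (sucn a)"
  unfolding is_name_iff[of P "sucn a"] elts_sucn using is_name_iff[of P a] by auto

lemma name_empty [simp]: "name (vset {})"
  by (subst is_name_iff) simp

lemma forces_mem_empty: "p \<in>\<^sub>V P \<Longrightarrow> \<not> p \<tturnstile> a \<epsilon> vset {}"
  unfolding forces_mem_iff dense_below_def using le_refl by auto

lemma forces_mem_upn:
  "p \<tturnstile> \<tau> \<epsilon> upn a b \<longleftrightarrow> dense_below p (\<lambda>r. r \<tturnstile> \<tau> \<approx> a \<or> r \<tturnstile> \<tau> \<approx> b)"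
proof -
  have "(\<exists>\<sigma> s. pair \<sigma> s \<in>\<^sub>V upn a b \<and> r \<preceq> s \<and> r \<tturnstile> \<tau> \<approx> \<sigma>) \<longleftrightarrow> r \<tturnstile> \<tau> \<approx> a \<or> r \<tturnstile> \<tau> \<approx> b"
    if "r \<preceq> q" for r q
    using le_carrier[OF that] le_refl'[OF that] by auto
  then show ?thesis
    unfolding forces_mem_iff dense_below_def by meson
qed

lemma forces_mem_sucn:
  "p \<tturnstile> \<tau> \<epsilon> sucn a \<longleftrightarrow> dense_below p (\<lambda>r. r \<tturnstile> \<tau> \<epsilon> a \<or> r \<tturnstile> \<tau> \<approx> a)"
proof
  assume "p \<tturnstile> \<tau> \<epsilon> sucn a"
  then show "dense_below p (\<lambda>r. r \<tturnstile> \<tau> \<epsilon> a \<or> r \<tturnstile> \<tau> \<approx> a)"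
    unfolding forces_mem_iff[of p]
  proof (rule dense_below_mono, elim exE conjE)
    fix r \<sigma> s
    assume r: "pair \<sigma> s \<in>\<^sub>V sucn a" "r \<preceq> s" "r \<tturnstile> \<tau> \<approx> \<sigma>"
    then have "r \<tturnstile> \<tau> \<epsilon> a \<or> r \<tturnstile> \<tau> \<approx> a"
      using forces_mem_cong[OF forces_mem_pair forces_eq_sym forces_eq_refl] by auto
    then show "dense_below r (\<lambda>r. r \<tturnstile> \<tau> \<epsilon> a \<or> r \<tturnstile> \<tau> \<approx> a)"
      using forces_mem_mono forces_eq_mono by (blast intro: dense_below_all)
  qed
next
  assume "dense_below p (\<lambda>r. r \<tturnstile> \<tau> \<epsilon> a \<or> r \<tturnstile> \<tau> \<approx> a)"
  then show "p \<tturnstile> \<tau> \<epsilon> sucn a"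
  proof (intro dense_forces_mem, elim dense_below_mono disjE)
    fix r
    assume "r \<preceq> p" "r \<tturnstile> \<tau> \<epsilon> a"
    then have "r \<tturnstile> \<tau> \<epsilon> sucn a"
      by (elim forces_mem_reduce) (rule forces_memI, rule pair_mem_sucn[THEN iffD2], blast)
    then show "dense_below r (\<lambda>r. r \<tturnstile> \<tau> \<epsilon> sucn a)"
      by (blast intro: dense_below_all forces_mem_mono)
  next
    fix r
    assume r: "r \<preceq> p" "r \<tturnstile> \<tau> \<approx> a"
    then have "r \<tturnstile> \<tau> \<epsilon> sucn a"
      using le_carrier[OF r(1)] le_refl by (intro forces_memI[of a r]) auto
    then show "dense_below r (\<lambda>r. r \<tturnstile> \<tau> \<epsilon> sucn a)"
      by (blast intro: dense_below_all forces_mem_mono)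
  qed
qed

text \<open>Eliminates a bounded quantifier whose witness is determined up to forced equality, as
  happens in \<open>fm_rel\<close> and \<open>fm_inductive\<close>.\<close>

lemma ex_forces_mem_eq:
  assumes "name t"
  shows "dense_below p (\<lambda>q. \<exists>\<tau>. name \<tau> \<and> q \<tturnstile> \<tau> \<epsilon> u \<and> q \<tturnstile> \<tau> \<approx> t) \<longleftrightarrow> p \<tturnstile> t \<epsilon> u"
proof
  assume "dense_below p (\<lambda>q. \<exists>\<tau>. name \<tau> \<and> q \<tturnstile> \<tau> \<epsilon> u \<and> q \<tturnstile> \<tau> \<approx> t)"
  then have "dense_below p (\<lambda>q. q \<tturnstile> t \<epsilon> u)"
    unfolding dense_below_def using forces_mem_cong[OF _ _ forces_eq_refl] by blast
  then show "p \<tturnstile> t \<epsilon> u"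
    by (rule dense_forces_mem)
next
  assume "p \<tturnstile> t \<epsilon> u"
  then show "dense_below p (\<lambda>q. \<exists>\<tau>. name \<tau> \<and> q \<tturnstile> \<tau> \<epsilon> u \<and> q \<tturnstile> \<tau> \<approx> t)"
    using assms by (intro dense_below_all) (blast intro: forces_mem_mono forces_eq_refl)
qed

lemma upn_commute: "upn a b = upn b a"
  by (simp add: upn_def insert_commute)

lemma forces_mem_upnI: "p \<tturnstile> a \<epsilon> upn a b" "p \<tturnstile> b \<epsilon> upn a b"
  unfolding forces_mem_upn by (rule dense_below_all, simp add: forces_eq_refl)+

text \<open>Below any condition, decide whether \<open>d\<close> is \<open>a\<close> or
  \<open>b\<close>, and then whether \<open>b\<close> is \<open>c\<close> or \<open>d\<close>. The
  only case not giving \<open>b\<close> equal to \<open>d\<close> outright is closed by chaining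
  through \<open>a\<close> and \<open>c\<close>.\<close>

lemma upn_inject_aux:
  assumes eq: "p \<tturnstile> upn a b \<approx> upn c d" and ac: "p \<tturnstile> a \<approx> c"
  shows "p \<tturnstile> b \<approx> d"
proof (rule dense_forces_eq, rule dense_belowI)
  fix q
  assume q: "q \<preceq> p"
  have b: "p \<tturnstile> b \<epsilon> upn c d" and d: "p \<tturnstile> d \<epsilon> upn a b"
    using forces_mem_cong[OF forces_mem_upnI(2) forces_eq_refl eq]
      forces_mem_cong[OF forces_mem_upnI(2) forces_eq_refl forces_eq_sym[OF eq]] .
  obtain r where r: "r \<preceq> q" "r \<tturnstile> d \<approx> a \<or> r \<tturnstile> d \<approx> b"
    using d q unfolding forces_mem_upn dense_below_def by blast
  have "r \<preceq> p"
    using r(1) q le_trans by blast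
  obtain t where t: "t \<preceq> r" "t \<tturnstile> b \<approx> c \<or> t \<tturnstile> b \<approx> d"
    using b \<open>r \<preceq> p\<close> unfolding forces_mem_upn dense_below_def by blast
  have "t \<tturnstile> a \<approx> c" "t \<tturnstile> d \<approx> a \<or> t \<tturnstile> d \<approx> b"
    using forces_eq_mono r t(1) ac \<open>r \<preceq> p\<close> le_trans by blast+
  then have "t \<tturnstile> b \<approx> d"
    using t(2) forces_eq_sym forces_eq_trans by meson
  then show "\<exists>r. r \<preceq> q \<and> r \<tturnstile> b \<approx> d"
    using t(1) r(1) le_trans by blast
qed

lemma upn_inject:
  assumes eq: "p \<tturnstile> upn a b \<approx> upn c d"
  shows "dense_below p (\<lambda>r. r \<tturnstile> a \<approx> c \<and> r \<tturnstile> b \<approx> d \<or> r \<tturnstile> a \<approx> d \<and> r \<tturnstile> b \<approx> c)"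
proof (rule dense_belowI)
  fix q
  assume q: "q \<preceq> p"
  have "p \<tturnstile> a \<epsilon> upn c d"
    using forces_mem_cong[OF forces_mem_upnI(1) forces_eq_refl eq] .
  then obtain r where r: "r \<preceq> q" "r \<tturnstile> a \<approx> c \<or> r \<tturnstile> a \<approx> d"
    using q unfolding forces_mem_upn dense_below_def by blast
  have "r \<tturnstile> upn a b \<approx> upn c d"
    using eq r(1) q le_trans forces_eq_mono by blast
  then show "\<exists>r. r \<preceq> q \<and> (r \<tturnstile> a \<approx> c \<and> r \<tturnstile> b \<approx> d \<or> r \<tturnstile> a \<approx> d \<and> r \<tturnstile> b \<approx> c)"
    using r upn_inject_aux upn_commute by metis
qed

lemma upn_singleton_inject:
  assumes "p \<tturnstile> upn a a \<approx> upn c d"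
  shows "p \<tturnstile> a \<approx> c" "p \<tturnstile> a \<approx> d"
  using upn_inject[OF assms] unfolding dense_below_def
  by (intro dense_forces_eq dense_belowI; blast)+

text \<open>Kuratowski's argument, at conditions deciding how the components of the outer pairs
  match. In the crossed case all four names become equal.\<close>

lemma opn_inject:
  assumes "p \<tturnstile> opn a b \<approx> opn c d"
  shows "p \<tturnstile> a \<approx> c" "p \<tturnstile> b \<approx> d"
proof -
  have "dense_below p (\<lambda>r. r \<tturnstile> a \<approx> c \<and> r \<tturnstile> b \<approx> d)"
    using upn_inject[OF assms[unfolded opn_def]]
  proof (rule dense_below_mono)
    fix r
    assume r: "r \<tturnstile> upn a a \<approx> upn c c \<and> r \<tturnstile> upn a b \<approx> upn c d \<or>
      r \<tturnstile> upn a a \<approx> upn c d \<and> r \<tturnstile> upn a b \<approx> upn c c"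
    have "r \<tturnstile> a \<approx> c"
      using r upn_singleton_inject by blast
    moreover have "r \<tturnstile> b \<approx> d"
      using r
    proof (elim disjE conjE)
      assume "r \<tturnstile> upn a b \<approx> upn c d"
      then show ?thesis
        using upn_inject_aux \<open>r \<tturnstile> a \<approx> c\<close> by blast
    next
      assume "r \<tturnstile> upn a a \<approx> upn c d" "r \<tturnstile> upn a b \<approx> upn c c"
      then have "r \<tturnstile> a \<approx> d" "r \<tturnstile> c \<approx> b"
        using upn_singleton_inject forces_eq_sym by blast+
      then show ?thesis
        using \<open>r \<tturnstile> a \<approx> c\<close> forces_eq_sym forces_eq_trans by meson
    qed
    ultimately show "dense_below r (\<lambda>r. r \<tturnstile> a \<approx> c \<and> r \<tturnstile> b \<approx> d)"
      using forces_eq_mono by (blast intro: dense_below_all)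
  qed
  then show "p \<tturnstile> a \<approx> c" "p \<tturnstile> b \<approx> d"
    unfolding dense_below_def by (intro dense_forces_eq dense_belowI; blast)+
qed

lemma upn_cong:
  assumes "p \<tturnstile> a \<approx> c" "p \<tturnstile> b \<approx> d"
  shows "p \<tturnstile> upn a b \<approx> upn c d"
proof -
  have "q \<tturnstile> \<sigma> \<epsilon> upn c' d'"
    if "p \<tturnstile> a' \<approx> c'" "p \<tturnstile> b' \<approx> d'" "pair \<sigma> s \<in>\<^sub>V upn a' b'" "q \<preceq> p" for \<sigma> s q a' b' c' d'
    using that forces_eq_mono le_trans unfolding forces_mem_upn
    by (intro dense_below_all) (metis pair_mem_upn)
  then show ?thesis
    unfolding forces_eq_iff[of p "upn a b"] using assms assms[THEN forces_eq_sym] by blast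
qed

lemma opn_cong: "p \<tturnstile> a \<approx> c \<Longrightarrow> p \<tturnstile> b \<approx> d \<Longrightarrow> p \<tturnstile> opn a b \<approx> opn c d"
  unfolding opn_def by (intro upn_cong)

section \<open>Translating the auxiliary formulas into statements about names\<close>

lemma forces_fm_upair:
  assumes "10 \<notin> {z, x, y}" "name (e z)" "name (e x)" "name (e y)"
  shows "forces P R p (fm_upair z x y) e \<longleftrightarrow> p \<tturnstile> e z \<approx> upn (e x) (e y)"
  using assms unfolding fm_upair_def
  by (simp add: forces.simps(5) forces_Iff forces_Disj forces_mem_upn forces_eq_extensional)

text \<open>The formula binds variable 11 and, through \<open>fm_upair\<close>, variable 10; the
  index condition keeps both from overwriting an argument.\<close>

lemma forces_fm_pair:
  assumes "{10, 11} \<inter> {w, x, y} = {}" "name (e w)" "name (e x)" "name (e y)"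
  shows "forces P R p (fm_pair w x y) e \<longleftrightarrow> p \<tturnstile> e w \<approx> opn (e x) (e y)"
  using assms unfolding fm_pair_def opn_def
  by (simp add: forces.simps(5) forces_Iff forces_Disj forces_fm_upair forces_mem_upn
      forces_eq_extensional[of "e w"])

lemma forces_fm_rel:
  assumes "{10, 11, 12} \<inter> {r, x, y} = {}" "name (e r)" "name (e x)" "name (e y)"
  shows "forces P R p (fm_rel r x y) e \<longleftrightarrow> p \<tturnstile> opn (e x) (e y) \<epsilon> e r"
proof -
  have "forces P R p (fm_rel r x y) e \<longleftrightarrow>
    dense_below p (\<lambda>q. \<exists>\<tau>. name \<tau> \<and> q \<tturnstile> \<tau> \<epsilon> e r \<and> q \<tturnstile> \<tau> \<approx> opn (e x) (e y))"
    using assms by (simp add: fm_rel_def forces_ExIn forces_fm_pair cong: conj_cong)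
  then show ?thesis
    using assms by (simp add: ex_forces_mem_eq)
qed

lemma forces_fm_compatible:
  assumes "{9, 10, 11, 12} \<inter> {i, j, x, y} = {}" "name (e i)" "name (e j)" "name (e x)" "name (e y)"
  shows "forces P R p (fm_compatible i j x y) e \<longleftrightarrow> dense_below p (\<lambda>q. \<exists>\<tau>. name \<tau> \<and>
    q \<tturnstile> \<tau> \<epsilon> e i \<and> q \<tturnstile> opn \<tau> (e x) \<epsilon> e j \<and> q \<tturnstile> opn \<tau> (e y) \<epsilon> e j)"
  using assms by (simp add: fm_compatible_def forces_ExIn forces_fm_rel cong: conj_cong)

lemma forces_fm_empty:
  assumes "x \<noteq> 10" "name (e x)"
  shows "forces P R p (fm_empty x) e \<longleftrightarrow> p \<tturnstile> e x \<approx> vset {}"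
  using assms forces_mem_empty le_carrier
  by (auto simp: fm_empty_def forces.simps(5) forces_eq_extensional)

lemma forces_fm_succ:
  assumes "10 \<notin> {x, y}" "name (e x)" "name (e y)"
  shows "forces P R p (fm_succ y x) e \<longleftrightarrow> p \<tturnstile> e y \<approx> sucn (e x)"
  using assms unfolding fm_succ_def
  by (simp add: forces.simps(5) forces_Iff forces_Disj forces_mem_sucn forces_eq_extensional)

lemma forces_fm_inductive:
  assumes "u \<notin> {10, 11, 12}" "name (e u)"
  shows "forces P R p (fm_inductive u) e \<longleftrightarrow> p \<tturnstile> vset {} \<epsilon> e u \<and>
    (\<forall>\<tau>. name \<tau> \<longrightarrow> (\<forall>q. q \<preceq> p \<longrightarrow> q \<tturnstile> \<tau> \<epsilon> e u \<longrightarrow> q \<tturnstile> sucn \<tau> \<epsilon> e u))"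
  using assms unfolding fm_inductive_def
  by (simp add: forces_ExIn forces_AllIn forces_fm_empty forces_fm_succ ex_forces_mem_eq cong: conj_cong)

subsection \<open>Canonical names\<close>

lemma elts_check: "elts (check P x) = (\<lambda>(\<sigma>, p). pair \<sigma> p) ` (check P ` elts x \<times> elts P)"
  by (subst check.simps) (intro elts_vset small_pairs small_image small_elts)

lemma pair_mem_check: "pair \<sigma> s \<in>\<^sub>V check P x \<longleftrightarrow> (\<exists>y. y \<in>\<^sub>V x \<and> \<sigma> = check P y) \<and> s \<in>\<^sub>V P"
  unfolding mem_elts[symmetric] elts_check by auto

lemma name_check [simp]: "name (check P x)"
proof (induction x rule: vmem_induct)
  case (vmem x)
  then show ?case
    by (subst is_name_iff) (auto simp: elts_check)
qed

lemma forces_mem_check: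
  "p \<tturnstile> \<tau> \<epsilon> check P x \<longleftrightarrow> dense_below p (\<lambda>r. \<exists>y. y \<in>\<^sub>V x \<and> r \<tturnstile> \<tau> \<approx> check P y)"
  unfolding forces_mem_iff dense_below_def pair_mem_check
  by (metis le_carrier le_refl)

lemma forces_check_mem: "y \<in>\<^sub>V x \<Longrightarrow> p \<tturnstile> check P y \<epsilon> check P x"
  unfolding forces_mem_check by (blast intro: dense_below_all forces_eq_refl)

text \<open>Induction on \<open>x\<close>: some condition below \<open>p\<close> matches an element
  of one set with an element of the other, and the induction hypothesis makes the match an equality.
  The condition must lie in \<open>P\<close>, as anything else forces every atomic
  statement.\<close>

lemma forces_check_eqD: "p \<tturnstile> check P x \<approx> check P y \<Longrightarrow> p \<in>\<^sub>V P \<Longrightarrow> x = y"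
proof (induction x arbitrary: y p rule: vmem_induct)
  case (vmem x)
  have "z \<in>\<^sub>V y" if z: "z \<in>\<^sub>V x" for z
  proof -
    have "p \<tturnstile> check P z \<epsilon> check P y"
      using forces_mem_cong[OF forces_check_mem[OF z] forces_eq_refl vmem.prems(1)] .
    then obtain r w where "r \<preceq> p" "w \<in>\<^sub>V y" "r \<tturnstile> check P z \<approx> check P w"
      using le_refl[OF vmem.prems(2)] unfolding forces_mem_check dense_below_def by blast
    then show ?thesis
      using vmem.IH[OF z] le_carrier by metis
  qed
  moreover have "z \<in>\<^sub>V x" if z: "z \<in>\<^sub>V y" for z
  proof -
    have "p \<tturnstile> check P z \<epsilon> check P x"
      using forces_mem_cong[OF forces_check_mem[OF z] forces_eq_refl forces_eq_sym[OF vmem.prems(1)]] .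
    then obtain r w where "r \<preceq> p" "w \<in>\<^sub>V x" "r \<tturnstile> check P w \<approx> check P z"
      using le_refl[OF vmem.prems(2)] forces_eq_sym unfolding forces_mem_check dense_below_def by blast
    then show ?thesis
      using vmem.IH[of w r z] le_carrier by metis
  qed
  ultimately show ?case
    by (intro extensionality) blast
qed

text \<open>An identity of sets, not just a forced equality, because \<open>check\<close> and
  \<open>upn\<close> attach the same conditions.\<close>

lemma check_upair: "check P (vset {a, b}) = upn (check P a) (check P b)"
  unfolding upn_def by (subst check.simps) (simp add: small_upair)

lemma check_pair: "check P (pair a b) = opn (check P a) (check P b)"
  using check_upair[of a a] check_upair by (simp add: pair_def opn_def)

lemma check_empty: "check P (vset {}) = vset {}"
  by (subst check.simps) simp

lemma check_suc: "check P (vset (insert a (elts a))) = sucn (check P a)"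
proof (rule iffD1[OF elts_inject])
  have "elts (vset (insert a (elts a))) = insert a (elts a)"
    by simp
  then show "elts (check P (vset (insert a (elts a)))) = elts (sucn (check P a))"
    by (simp only: elts_check elts_sucn) auto
qed

lemma forces_opn_mem_check:
  assumes "p \<tturnstile> opn \<sigma> \<tau> \<epsilon> check P f" "\<And>w. w \<in>\<^sub>V f \<Longrightarrow> \<exists>a b. w = pair a b"
  shows "dense_below p (\<lambda>r. \<exists>a b. pair a b \<in>\<^sub>V f \<and> r \<tturnstile> \<sigma> \<approx> check P a \<and> r \<tturnstile> \<tau> \<approx> check P b)"
  using assms(1) unfolding forces_mem_check dense_below_def
  by (metis assms(2) check_pair opn_inject)

lemma forces_opn_mem_checkI:
  assumes "p \<tturnstile> \<sigma> \<approx> check P a" "p \<tturnstile> \<tau> \<approx> check P b" "pair a b \<in>\<^sub>V f"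
  shows "p \<tturnstile> opn \<sigma> \<tau> \<epsilon> check P f"
  using forces_mem_cong[OF forces_check_mem[OF assms(3)] _ forces_eq_refl] assms(1,2)
  by (simp add: check_pair opn_cong forces_eq_sym)

lemma sucn_cong:
  assumes "p \<tturnstile> a \<approx> b" "name a" "name b"
  shows "p \<tturnstile> sucn a \<approx> sucn b"
proof -
  have *: "r \<tturnstile> \<tau> \<epsilon> d \<or> r \<tturnstile> \<tau> \<approx> d"
    if "r \<tturnstile> \<tau> \<epsilon> c \<or> r \<tturnstile> \<tau> \<approx> c" "r \<tturnstile> c \<approx> d" for r \<tau> c d
    using that forces_mem_cong[OF _ forces_eq_refl] forces_eq_trans by blast
  have "r \<tturnstile> a \<approx> b" "r \<tturnstile> b \<approx> a" if "r \<preceq> q" "q \<preceq> p" for r q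
    using that assms(1) forces_eq_mono forces_eq_sym le_trans by blast+
  then have "q \<tturnstile> \<tau> \<epsilon> sucn a \<longleftrightarrow> q \<tturnstile> \<tau> \<epsilon> sucn b" if "q \<preceq> p" for q \<tau>
    unfolding forces_mem_sucn dense_below_def using that * le_trans by meson
  then show ?thesis
    using assms by (simp add: forces_eq_extensional)
qed

section \<open>The natural numbers of the extension\<close>

definition omega :: 'v where "omega = vset (range vnat)"

lemma mem_omega: "x \<in>\<^sub>V omega \<longleftrightarrow> (\<exists>n. x = vnat n)"
  by (auto simp: omega_def small_range_vnat)

lemma check_omega_suc:
  assumes "name \<tau>" "p \<tturnstile> \<tau> \<epsilon> check P omega"
  shows "p \<tturnstile> sucn \<tau> \<epsilon> check P omega"
proof (rule dense_forces_mem, rule dense_belowI)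
  fix q
  assume "q \<preceq> p"
  then obtain r n where r: "r \<preceq> q" "r \<tturnstile> \<tau> \<approx> check P (vnat n)"
    using assms(2) unfolding forces_mem_check dense_below_def mem_omega by blast
  have "r \<tturnstile> check P (vnat (Suc n)) \<approx> sucn \<tau>"
    using sucn_cong[OF r(2) assms(1) name_check] by (simp add: check_suc forces_eq_sym)
  then have "r \<tturnstile> sucn \<tau> \<epsilon> check P omega"
    using forces_mem_cong[OF forces_check_mem _ forces_eq_refl] mem_omega by blast
  then show "\<exists>r. r \<preceq> q \<and> r \<tturnstile> sucn \<tau> \<epsilon> check P omega"
    using r(1) by blast
qed

text \<open>Induction on the actual natural numbers puts every \<open>check P (vnat n)\<close> into
  \<open>u\<close>, and \<tau> is densely equal to one of these.\<close>

lemma check_omega_least: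
  assumes "q \<tturnstile> vset {} \<epsilon> u"
    and "\<And>\<tau> r. name \<tau> \<Longrightarrow> r \<preceq> q \<Longrightarrow> r \<tturnstile> \<tau> \<epsilon> u \<Longrightarrow> r \<tturnstile> sucn \<tau> \<epsilon> u"
    and "r \<preceq> q" "r \<tturnstile> \<tau> \<epsilon> check P omega"
  shows "r \<tturnstile> \<tau> \<epsilon> u"
proof (rule dense_forces_mem, rule dense_belowI)
  have vnat: "t \<tturnstile> check P (vnat n) \<epsilon> u" if "t \<preceq> q" for t n
  proof (induction n)
    case 0
    then show ?case
      using assms(1) that by (simp add: check_empty forces_mem_mono)
  next
    case (Suc n)
    then show ?case
      using assms(2) that by (simp add: check_suc)
  qed
  fix t
  assume t: "t \<preceq> r"
  then obtain s n where s: "s \<preceq> t" "s \<tturnstile> \<tau> \<approx> check P (vnat n)"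
    using assms(4) unfolding forces_mem_check dense_below_def mem_omega by blast
  then have "s \<tturnstile> \<tau> \<epsilon> u"
    using forces_mem_cong[OF vnat forces_eq_sym forces_eq_refl] t assms(3) le_trans by blast
  then show "\<exists>s. s \<preceq> t \<and> s \<tturnstile> \<tau> \<epsilon> u"
    using s(1) by blast
qed

lemma forces_fm_omega:
  assumes "w \<notin> {10, 11, 12, 13}" "e w = check P omega"
  shows "forces P R p (fm_omega w) e"
proof -
  have "p \<tturnstile> vset {} \<epsilon> check P omega"
    using forces_check_mem[OF mem_omega[THEN iffD2, OF exI, OF refl], of p 0] by (simp add: check_empty)
  then have "forces P R p (fm_inductive w) e"
    using assms check_omega_suc by (auto simp: forces_fm_inductive)
  moreover have "forces P R q (AllIn 11 w (Mem 11 13)) (e(13 := u))"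
    if "name u" "forces P R q (fm_inductive 13) (e(13 := u))" for q u
  proof -
    have u: "q \<tturnstile> vset {} \<epsilon> u" "\<And>\<tau> r. name \<tau> \<Longrightarrow> r \<preceq> q \<Longrightarrow> r \<tturnstile> \<tau> \<epsilon> u \<Longrightarrow> r \<tturnstile> sucn \<tau> \<epsilon> u"
      using that(2) unfolding forces_fm_inductive[of 13 "e(13 := u)", simplified, OF that(1)] by blast+
    show ?thesis
      unfolding forces_AllIn
    proof (intro allI impI)
      fix \<tau> r
      assume "r \<preceq> q" "r \<tturnstile> \<tau> \<epsilon> (e(13 := u, 11 := \<tau>)) w"
      then show "forces P R r (Mem 11 13) (e(13 := u, 11 := \<tau>))"
        using check_omega_least[OF u] assms by simp
    qed
  qed
  ultimately show ?thesis
    by (simp add: fm_omega_def forces.simps(5) forces_Imp)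
qed

end

section \<open>Predense subsets under the countable chain condition\<close>

text \<open>Zorn's lemma gives a maximal antichain \<open>A\<close> of conditions below members of
  \<open>E\<close>; it is countable by the chain condition. By maximality no element of
  \<open>E\<close> is incompatible with all of \<open>A\<close>, and replacing each element of
  \<open>A\<close> by a member of \<open>E\<close> above it preserves compatibility.\<close>

lemma ccc_countable_predense:
  assumes Q: "forcing Q R" and ccc: "ccc Q R" and E: "E \<subseteq> elts Q"
  obtains B where "B \<subseteq> E" "countable B" "\<And>a. a \<in> E \<Longrightarrow> \<exists>b\<in>B. compatible Q R a b"
proof -
  define antichain where "antichain A \<longleftrightarrow>
      (\<forall>p\<in>A. \<forall>q\<in>A. p \<noteq> q \<longrightarrow> \<not> compatible Q R p q)" for A
  define D where "D = {c \<in> elts Q. \<exists>b\<in>E. le R c b}"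
  define \<A> where "\<A> = {A. A \<subseteq> D \<and> antichain A}"
  interpret Q: forcing_notion Q R
    by unfold_locales (rule Q)
  have "\<Union>\<C> \<in> \<A>" if "subset.chain \<A> \<C>" for \<C>
  proof -
    have sub: "\<C> \<subseteq> \<A>" and chain: "\<And>X Y. X \<in> \<C> \<Longrightarrow> Y \<in> \<C> \<Longrightarrow> X \<subseteq> Y \<or> Y \<subseteq> X"
      using that unfolding subset_chain_def by blast+
    have "antichain (\<Union>\<C>)"
      unfolding antichain_def
    proof (intro ballI)
      fix p q
      assume "p \<in> \<Union>\<C>" "q \<in> \<Union>\<C>"
      then obtain X where "X \<in> \<C>" "p \<in> X" "q \<in> X"
        using chain by (metis UnionE subsetD)
      then show "p \<noteq> q \<longrightarrow> \<not> compatible Q R p q"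
        using sub unfolding \<A>_def antichain_def by blast
    qed
    then show ?thesis
      using sub unfolding \<A>_def by blast
  qed
  then obtain A where A: "A \<in> \<A>" and max: "\<And>X. X \<in> \<A> \<Longrightarrow> A \<subseteq> X \<Longrightarrow> X = A"
    using subset_Zorn'[of \<A>] by blast
  have AD: "A \<subseteq> D" and "antichain A"
    using A by (simp_all add: \<A>_def)
  then have "countable A"
    using ccc unfolding ccc_def antichain_def D_def by blast
  have "\<forall>c\<in>A. \<exists>b. b \<in> E \<and> le R c b"
    using AD unfolding D_def by blast
  then obtain f where f: "\<And>c. c \<in> A \<Longrightarrow> f c \<in> E \<and> le R c (f c)"
    by metis
  show ?thesis
  proof
    show "f ` A \<subseteq> E" "countable (f ` A)"
      using f \<open>countable A\<close> by auto
    fix a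
    assume a: "a \<in> E"
    then have aQ: "a \<in> elts Q" and "le R a a"
      using E Q.le_refl by auto
    have "\<exists>c\<in>A. compatible Q R a c"
    proof (rule ccontr)
      assume neg: "\<not> ?thesis"
      then have "\<not> compatible Q R a c" "\<not> compatible Q R c a" if "c \<in> A" for c
        using that unfolding compatible_def by blast+
      then have "antichain (insert a A)"
        using \<open>antichain A\<close> unfolding antichain_def by blast
      moreover have "a \<in> D"
        using a aQ \<open>le R a a\<close> unfolding D_def by blast
      ultimately have "a \<in> A"
        using max[of "insert a A"] AD by (auto simp: \<A>_def)
      then show False
        using neg aQ \<open>le R a a\<close> unfolding compatible_def by blast
    qed
    then obtain c r where "c \<in> A" "r \<in> elts Q" "le R r a" "le R r c"
      unfolding compatible_def by blast
    then show "\<exists>b\<in>f ` A. compatible Q R a b"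
      using f Q.le_trans unfolding compatible_def by (metis imageI)
  qed
qed

section \<open>Coding countably many functions into an algebra\<close>

text \<open>
  A finite set \<open>s\<close> codes the application of \<open>g n\<close> to its least or to its greatest element, where
  \<open>n\<close> and the choice between the two are read off the cardinality of \<open>s\<close>. In an infinite set,
  every element has infinitely many elements above it or infinitely many elements below it.
\<close>

lemma ex_coding_function:
  fixes g :: "nat \<Rightarrow> 'a \<Rightarrow> 'a"
  assumes "P \<noteq> {}" and g: "\<And>n x. x \<in> P \<Longrightarrow> g n x \<in> P"
  obtains F where "\<And>s. F s \<in> P"
    "\<And>A n x. A \<subseteq> P \<Longrightarrow> infinite A \<Longrightarrow> (\<And>s. s \<subseteq> A \<Longrightarrow> finite s \<Longrightarrow> F s \<in> A) \<Longrightarrow> x \<in> A \<Longrightarrow> g n x \<in> A"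
proof -
  obtain p where "p \<in> P"
    using assms(1) by blast
  obtain r where r: "well_order_on P r"
    using well_order_on by blast
  then have refl: "\<And>x. x \<in> P \<Longrightarrow> (x, x) \<in> r" and anti: "antisym r"
      and total: "\<And>x y. x \<in> P \<Longrightarrow> y \<in> P \<Longrightarrow> (x, y) \<in> r \<or> (y, x) \<in> r"
    unfolding order_on_defs refl_on_def total_on_def by metis+
  define least where "least s = (THE x. x \<in> s \<and> (\<forall>y\<in>s. (x, y) \<in> r))" for s
  define greatest where "greatest s = (THE x. x \<in> s \<and> (\<forall>y\<in>s. (y, x) \<in> r))" for s
  \<comment> \<open>Sets of size \<open>2 * n + 2\<close> apply \<open>g n\<close> to the least
    element, those of size \<open>2 * n + 3\<close> to the greatest. The shift keeps the empty set,
    which has neither, from being used as a code.\<close>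
  define G where "G s = g (card s div 2 - 1) (if even (card s) then least s else greatest s)" for s
  \<comment> \<open>The default \<open>p\<close> catches arguments at which \<open>G\<close> would
    leave \<open>P\<close>.\<close>
  define F where "F s = (if G s \<in> P then G s else p)" for s
  show ?thesis
  proof
    show "F s \<in> P" for s
      by (simp add: F_def \<open>p \<in> P\<close>)
    fix A n x
    assume A: "A \<subseteq> P" "infinite A" and closed: "\<And>s. s \<subseteq> A \<Longrightarrow> finite s \<Longrightarrow> F s \<in> A" and x: "x \<in> A"
    define up where "up = {y \<in> A. (x, y) \<in> r} - {x}"
    define down where "down = {y \<in> A. (y, x) \<in> r} - {x}"
    have "x \<in> P"
      using A x by blast
    have "A = insert x (up \<union> down)"
      using total A x unfolding up_def down_def by blast
    then have "infinite (up \<union> down)"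
      using A(2) finite_insert by metis
    then consider "infinite up" | "infinite down"
      by blast
    then obtain s where s: "s \<subseteq> A" "finite s" "G s = g n x"
    proof cases
      case 1
      then obtain T where T: "finite T" "card T = 2 * n + 1" "T \<subseteq> up"
        using infinite_arbitrarily_large by blast
      have "least (insert x T) = x"
        unfolding least_def
        by (rule the_equality)
          (use T refl[OF \<open>x \<in> P\<close>] anti in \<open>auto simp: up_def antisym_def\<close>)
      moreover have "card (insert x T) = 2 * n + 2"
        using T by (subst card_insert_disjoint) (auto simp: up_def)
      moreover have "insert x T \<subseteq> A"
        using T x by (auto simp: up_def)
      ultimately show ?thesis
        using that[of "insert x T"] T by (simp add: G_def)
    next
      case 2
      then obtain T where T: "finite T" "card T = 2 * n + 2" "T \<subseteq> down"
        using infinite_arbitrarily_large by blast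
      have "greatest (insert x T) = x"
        unfolding greatest_def
        by (rule the_equality)
          (use T refl[OF \<open>x \<in> P\<close>] anti in \<open>auto simp: down_def antisym_def\<close>)
      moreover have "card (insert x T) = 2 * n + 3"
        using T by (subst card_insert_disjoint) (auto simp: down_def)
      moreover have "insert x T \<subseteq> A"
        using T x by (auto simp: down_def)
      ultimately show ?thesis
        using that[of "insert x T"] T by (simp add: G_def)
    qed
    then show "g n x \<in> A"
      using closed[of s] g[OF \<open>x \<in> P\<close>] by (simp add: F_def)
  qed
qed

text \<open>An algebra has to be an element of V before it can belong to a model, so the graph of
  the HOL coding function is formed as a set.\<close>

lemma ex_coding_algebra:
  fixes P :: "'v::zfc" and g :: "nat \<Rightarrow> 'v \<Rightarrow> 'v"
  assumes "elts P \<noteq> {}" and "\<And>n x. x \<in>\<^sub>V P \<Longrightarrow> g n x \<in>\<^sub>V P"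
  obtains F where "algebra_over F P"
    "\<And>A n x. elts A \<subseteq> elts P \<Longrightarrow> infinite (elts A) \<Longrightarrow> closed_under_algebra F A \<Longrightarrow>
      x \<in>\<^sub>V A \<Longrightarrow> g n x \<in>\<^sub>V A"
proof -
  obtain G where G: "\<And>s. G s \<in> elts P"
    and closed: "\<And>A n x. A \<subseteq> elts P \<Longrightarrow> infinite A \<Longrightarrow>
      (\<And>s. s \<subseteq> A \<Longrightarrow> finite s \<Longrightarrow> G s \<in> A) \<Longrightarrow> x \<in> A \<Longrightarrow> g n x \<in> A"
    using ex_coding_function[OF assms(1), of g] assms(2) by (metis mem_elts)
  define F where "F = vset ((\<lambda>s. pair s (G (elts s))) ` {s. elts s \<subseteq> elts P \<and> finite (elts s)})"
  have "small ((\<lambda>s. pair s (G (elts s))) ` {s. elts s \<subseteq> elts P \<and> finite (elts s)})"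
    by (intro small_image small_subset[OF small_Pow[of P]]) blast
  then have F: "w \<in>\<^sub>V F \<longleftrightarrow> (\<exists>s. elts s \<subseteq> elts P \<and> finite (elts s) \<and> w = pair s (G (elts s)))" for w
    unfolding F_def by auto
  show ?thesis
  proof
    show "algebra_over F P"
      unfolding algebra_over_def using G by (auto simp: F)
    fix A n x
    assume A: "elts A \<subseteq> elts P" "infinite (elts A)" "closed_under_algebra F A" "x \<in>\<^sub>V A"
    have "G s \<in> elts A" if s: "s \<subseteq> elts A" "finite s" for s
    proof -
      have "elts (vset s) = s"
        using s small_subset[OF small_elts] by (intro elts_vset) blast
      moreover from this have "pair (vset s) (G s) \<in>\<^sub>V F"
        using A(1) s by (metis F subset_trans)
      ultimately show ?thesis
        using A(3) s unfolding closed_under_algebra_def by metis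
    qed
    then show "g n x \<in>\<^sub>V A"
      using closed[OF A(1,2)] A(4) by (metis mem_elts)
  qed
qed

section \<open>Preservation of the countable chain condition\<close>

text \<open>Needed to place the numerals in \<open>H \<theta>\<close>.\<close>

lemma tc_vnat: "tc (vnat n :: 'v::zfc) \<subseteq> range vnat"
proof (induction n rule: less_induct)
  case (less n)
  then show ?case
    unfolding tc_eq[of "vnat n"] elts_vnat by auto
qed

context forcing_notion
begin

text \<open>Isolates what the preservation argument uses of almost strong properness. What remains
  of the model is the countable set \<open>N\<close> covering the closed sets that witness
  genericity.\<close>

lemma almost_strongly_proper_extension:
  assumes asp: "almost_strongly_proper P R" and p: "p \<in>\<^sub>V P" and F: "algebra_over F P"
  obtains p' N where "p' \<preceq> p" "countable N"
    "\<And>q. q \<preceq> p' \<Longrightarrow> \<exists>Y q'. elts Y \<subseteq> elts P \<and> infinite (elts Y) \<and> elts Y \<subseteq> N \<and>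
      closed_under_algebra F Y \<and> q' \<in>\<^sub>V Y \<and> (\<forall>r. r \<in>\<^sub>V Y \<longrightarrow> r \<preceq> q' \<longrightarrow> compatible P R r q)"
proof -
  obtain \<kappa> where \<kappa>: "ordinal \<kappa>" and asp_\<kappa>: "\<And>\<theta>. regular_cardinal \<theta> \<Longrightarrow> \<kappa> \<in>\<^sub>V \<theta> \<Longrightarrow>
      \<exists>C. club_in C (H \<theta>) \<and> (\<forall>M \<in> C. elementary_submodel M (H \<theta>) \<and> vctbl_subsets P \<in> M \<and>
        (\<forall>p \<in> M \<inter> elts P. \<exists>p'. p' \<preceq> p \<and> almost_strongly_generic M P R p'))"
    using asp unfolding almost_strongly_proper_def by blast
  \<comment> \<open>\<open>X\<close> bounds the transitive closures of \<open>p\<close> and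
    \<open>F\<close>, the numerals make it infinite, and \<open>elts \<kappa>\<close> ensures that
    \<theta> lies above \<kappa>.\<close>
  define X where "X = vset (tc p \<union> tc F \<union> range vnat \<union> elts \<kappa>)"
  have X: "elts X = tc p \<union> tc F \<union> range vnat \<union> elts \<kappa>"
    unfolding X_def by (intro elts_vset small_Un small_tc small_range_vnat small_elts)
  have "infinite (range (vnat :: nat \<Rightarrow> 'v))"
    by (rule range_inj_infinite[OF inj_vnat])
  then have "infinite (elts X)"
    unfolding X by auto
  then obtain \<theta> :: 'v where \<theta>: "regular_cardinal \<theta>" "elts X \<prec> elts \<theta>"
    "\<And>\<alpha> :: 'v. ordinal \<alpha> \<Longrightarrow> elts \<alpha> \<lesssim> elts X \<Longrightarrow> \<alpha> \<in>\<^sub>V \<theta>"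
    using ex_regular_cardinal by blast
  have "\<kappa> \<in>\<^sub>V \<theta>"
    using \<kappa> X by (intro \<theta>(3) subset_imp_lepoll) auto
  then obtain C where C: "club_in C (H \<theta>)" and C_generic: "\<And>M p. M \<in> C \<Longrightarrow> p \<in> M \<inter> elts P \<Longrightarrow>
      \<exists>p'. p' \<preceq> p \<and> almost_strongly_generic M P R p'"
    using asp_\<kappa>[OF \<theta>(1)] by blast
  have "x \<in> H \<theta>" if "tc x \<subseteq> elts X" for x
    unfolding H_def using lesspoll_trans1[OF subset_imp_lepoll[OF that] \<theta>(2)] by simp
  \<comment> \<open>\<open>ctbl_subsets\<close> admits only infinite sets, so \<open>p\<close> and
    \<open>F\<close> are padded with numerals before the club supplies a model containing
    them.\<close>
  then have "{p, F} \<union> range vnat \<subseteq> H \<theta>"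
    using tc_vnat X by blast
  moreover have "infinite ({p, F} \<union> range (vnat :: nat \<Rightarrow> 'v))"
    using \<open>infinite (range vnat)\<close> by simp
  ultimately have "{p, F} \<union> range vnat \<in> ctbl_subsets (H \<theta>)"
    unfolding ctbl_subsets_def by simp
  then obtain M where M: "M \<in> C" "{p, F} \<union> range vnat \<subseteq> M"
    using C unfolding club_in_def by blast
  have "countable M"
    using M(1) C unfolding club_in_def ctbl_subsets_def by blast
  obtain p' where p': "p' \<preceq> p" "almost_strongly_generic M P R p'"
    using C_generic[OF M(1), of p] M(2) p by auto
  \<comment> \<open>Each witness \<open>Y\<close> will be a countable member of the countable model,
    so one countable union covers them all.\<close>
  define N where "N = (\<Union>Y\<in>{Y \<in> M. countable (elts Y)}. elts Y)"
  have "countable N"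
    unfolding N_def using \<open>countable M\<close> by (intro countable_UN) auto
  have sub: "Y \<in> elts (vctbl_subsets P) \<longleftrightarrow> elts Y \<in> ctbl_subsets (elts P)" for Y
  proof -
    have "small {Y. elts Y \<in> ctbl_subsets (elts P)}"
      by (rule small_subset[OF small_Pow[of P]]) (auto simp: ctbl_subsets_def)
    then show ?thesis
      by (simp add: vctbl_subsets_def)
  qed
  show ?thesis
  proof (rule that[OF p'(1) \<open>countable N\<close>])
    fix q
    assume q: "q \<preceq> p'"
    then have "stationary_for M P (S_set P R q)"
      using p'(2) le_carrier[OF q] unfolding almost_strongly_generic_def by auto
    then obtain Y where Y: "Y \<in> M" "Y \<in> S_set P R q" "closed_under_algebra F Y"
      using F M(2) unfolding stationary_for_def by auto
    then have "elts Y \<in> ctbl_subsets (elts P)"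
      unfolding S_set_def sub[symmetric] by blast
    moreover from this have "elts Y \<subseteq> N"
      unfolding N_def ctbl_subsets_def using Y(1) by blast
    moreover obtain q' where "q' \<in>\<^sub>V Y" "\<forall>r. r \<in>\<^sub>V Y \<longrightarrow> r \<preceq> q' \<longrightarrow> compatible P R r q"
      using Y(2) unfolding S_set_def by auto
    ultimately show "\<exists>Y q'. elts Y \<subseteq> elts P \<and> infinite (elts Y) \<and> elts Y \<subseteq> N \<and>
        closed_under_algebra F Y \<and> q' \<in>\<^sub>V Y \<and> (\<forall>r. r \<in>\<^sub>V Y \<longrightarrow> r \<preceq> q' \<longrightarrow> compatible P R r q)"
      using Y(3) unfolding ctbl_subsets_def by blast
  qed
qed

text \<open>The hypothesis \<open>anti\<close> states the antichain property for elements of the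
  ground model, so only atomic forcing with canonical names occurs here.\<close>

lemma antichain_countable_cover:
  assumes asp: "almost_strongly_proper P R" and Q: "forcing Q S" "ccc Q S" and p: "p \<in>\<^sub>V P"
    and anti: "\<And>q a b. q \<preceq> p \<Longrightarrow> a \<in>\<^sub>V Q \<Longrightarrow> b \<in>\<^sub>V Q \<Longrightarrow> q \<tturnstile> check P a \<epsilon> \<tau> \<Longrightarrow>
      q \<tturnstile> check P b \<epsilon> \<tau> \<Longrightarrow> compatible Q S a b \<Longrightarrow> a = b"
  obtains p' B where "p' \<preceq> p" "countable B"
    "\<And>q a. q \<preceq> p' \<Longrightarrow> a \<in>\<^sub>V Q \<Longrightarrow> q \<tturnstile> check P a \<epsilon> \<tau> \<Longrightarrow> a \<in> B"
proof -
  define E where "E x = {b. b \<in>\<^sub>V Q \<and> (\<exists>r. r \<preceq> x \<and> r \<tturnstile> check P b \<epsilon> \<tau>)}" for x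
  have "\<exists>B. B \<subseteq> E x \<and> countable B \<and> (\<forall>a\<in>E x. \<exists>b\<in>B. compatible Q S a b)" for x
    using ccc_countable_predense[OF Q, of "E x"] unfolding E_def
    by (metis (mono_tags, lifting) mem_Collect_eq mem_elts subsetI)
  then obtain B where B: "\<And>x. B x \<subseteq> E x" "\<And>x. countable (B x)"
    "\<And>x a. a \<in> E x \<Longrightarrow> \<exists>b\<in>B x. compatible Q S a b"
    by metis
  define b where "b n x = from_nat_into (B x) n" for n x
  \<comment> \<open>When \<open>B x\<close> is empty there is no condition to choose; the value
    \<open>x\<close> keeps \<open>g n\<close> a map from \<open>P\<close> to
    \<open>P\<close>.\<close>
  define g where "g n x = (if B x = {} then x else SOME r. r \<preceq> x \<and> r \<tturnstile> check P (b n x) \<epsilon> \<tau>)" for n x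
  have g: "g n x \<preceq> x \<and> g n x \<tturnstile> check P (b n x) \<epsilon> \<tau>" if "B x \<noteq> {}" for n x
  proof -
    have "b n x \<in> E x"
      using B(1) from_nat_into[OF that] unfolding b_def by blast
    then have "\<exists>r. r \<preceq> x \<and> r \<tturnstile> check P (b n x) \<epsilon> \<tau>"
      by (simp add: E_def)
    from someI_ex[OF this] show ?thesis
      using that by (simp add: g_def)
  qed
  then have "g n x \<in>\<^sub>V P" if "x \<in>\<^sub>V P" for n x
    using that le_carrier by (cases "B x = {}") (auto simp: g_def)
  moreover have "elts P \<noteq> {}"
    using p by auto
  ultimately obtain F where F: "algebra_over F P" and closed:
    "\<And>A n x. elts A \<subseteq> elts P \<Longrightarrow> infinite (elts A) \<Longrightarrow> closed_under_algebra F A \<Longrightarrow>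
      x \<in>\<^sub>V A \<Longrightarrow> g n x \<in>\<^sub>V A"
    using ex_coding_algebra[of P g] by blast
  obtain p' N where p': "p' \<preceq> p" and N: "countable N" and generic:
    "\<And>q. q \<preceq> p' \<Longrightarrow> \<exists>Y q'. elts Y \<subseteq> elts P \<and> infinite (elts Y) \<and> elts Y \<subseteq> N \<and>
      closed_under_algebra F Y \<and> q' \<in>\<^sub>V Y \<and> (\<forall>r. r \<in>\<^sub>V Y \<longrightarrow> r \<preceq> q' \<longrightarrow> compatible P R r q)"
    using almost_strongly_proper_extension[OF asp p F] by metis
  show ?thesis
  proof (rule that[OF p'])
    show "countable (\<Union>x\<in>N. B x)"
      using N B(2) by (intro countable_UN)
    fix q a
    assume q: "q \<preceq> p'" and a: "a \<in>\<^sub>V Q" "q \<tturnstile> check P a \<epsilon> \<tau>"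
    obtain Y q' where Y: "elts Y \<subseteq> elts P" "infinite (elts Y)" "elts Y \<subseteq> N"
      "closed_under_algebra F Y" "q' \<in>\<^sub>V Y"
      and compat: "\<And>r. r \<in>\<^sub>V Y \<Longrightarrow> r \<preceq> q' \<Longrightarrow> compatible P R r q"
      using generic[OF q] by blast
    have "q' \<preceq> q'" "q' \<in> N"
      using Y(1,3,5) le_refl by auto
    \<comment> \<open>First use of genericity, at \<open>q'\<close> itself: a common extension of
      \<open>q'\<close> and \<open>q\<close> still forces \<open>a\<close> into \<tau>, which puts
      \<open>a\<close> into \<open>E q'\<close>.\<close>
    then obtain t where "t \<preceq> q'" "t \<preceq> q"
      using compat[OF Y(5)] by (auto simp: compatible_def)
    then have "a \<in> E q'"
      using a forces_mem_mono unfolding E_def by blast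
    then obtain c where c: "c \<in> B q'" "compatible Q S a c"
      using B(3) by blast
    then obtain n where n: "c = b n q'"
      unfolding b_def using from_nat_into_surj[OF B(2)] by metis
    have "B q' \<noteq> {}"
      using c by blast
    \<comment> \<open>Second use, at \<open>g n q'\<close>, which lies in \<open>Y\<close> by
      closure under the algebra and below \<open>q'\<close> by its choice.\<close>
    then have "compatible P R (g n q') q"
      using compat[OF closed[OF Y(1,2,4,5)]] g by blast
    then obtain s where s: "s \<preceq> g n q'" "s \<preceq> q"
      by (auto simp: compatible_def)
    then have "s \<tturnstile> check P c \<epsilon> \<tau>" "s \<tturnstile> check P a \<epsilon> \<tau>"
      using g[OF \<open>B q' \<noteq> {}\<close>] a(2) n forces_mem_mono by blast+
    moreover have "c \<in>\<^sub>V Q"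
      using c(1) B(1) unfolding E_def by blast
    ultimately have "a = c"
      using anti[of s a c] a(1) c(2) le_trans[OF s(2) le_trans[OF q p']] by blast
    then show "a \<in> (\<Union>x\<in>N. B x)"
      using c(1) \<open>q' \<in> N\<close> by blast
  qed
qed

section \<open>Countability in the extension, and the preservation theorem\<close>

lemma forces_ExI: "name \<tau> \<Longrightarrow> forces P R p \<phi> (e(i := \<tau>)) \<Longrightarrow> forces P R p (Ex i \<phi>) e"
  unfolding forces_Ex by (rule dense_below_all) (blast intro: forces_mono)

text \<open>The witness is the canonical name of a ground-model injection of \<open>B\<close> into
  the natural numbers. Elements of \<open>e i\<close> are densely equal to canonical names from
  \<open>B\<close>, and canonical names forced equal denote the same set, so totality, functionality
  and injectivity reduce to the ground model.\<close>

lemma forces_fm_countable: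
  assumes i: "i \<notin> {4, 5, 6, 7, 8, 10, 11, 12, 13}" and "name (e i)" and "countable B"
    and B: "\<And>q \<sigma>. q \<preceq> p \<Longrightarrow> name \<sigma> \<Longrightarrow> q \<tturnstile> \<sigma> \<epsilon> e i \<Longrightarrow>
      dense_below q (\<lambda>r. \<exists>a\<in>B. r \<tturnstile> \<sigma> \<approx> check P a)"
  shows "forces P R p (fm_countable i) e"
proof -
  define k where "k a = (vnat (to_nat_on B a) :: 'v)" for a
  \<comment> \<open>The domain is \<open>B\<close>, which may exceed the named set;
    \<open>fm_countable\<close> looks only at arguments in that set.\<close>
  define f where "f = vset ((\<lambda>a. pair a (k a)) ` B)"
  have f: "w \<in>\<^sub>V f \<longleftrightarrow> (\<exists>a\<in>B. w = pair a (k a))" for w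
    unfolding f_def using small_countable[of "(\<lambda>a. pair a (k a)) ` B"] assms(3) by auto
  have k: "a = b" if "a \<in> B" "b \<in> B" "k a = k b" for a b
    using that assms(3) unfolding k_def by (simp add: inj_eq[OF inj_vnat])
  \<comment> \<open>A pair forced into the canonical name of \<open>f\<close> is densely the
    canonical name of a pair in \<open>f\<close>, so both coordinates are decided together.\<close>
  have rel: "dense_below q (\<lambda>r. \<exists>a\<in>B. r \<tturnstile> \<sigma> \<approx> check P a \<and> r \<tturnstile> \<upsilon> \<approx> check P (k a))"
    if "q \<tturnstile> opn \<sigma> \<upsilon> \<epsilon> check P f" for q \<sigma> \<upsilon>
    using forces_opn_mem_check[OF that] f unfolding dense_below_def by (metis pair_eq_iff)
  have total: "dense_below q (\<lambda>r. \<exists>\<upsilon>. name \<upsilon> \<and> r \<tturnstile> \<upsilon> \<epsilon> check P omega \<and> r \<tturnstile> opn \<sigma> \<upsilon> \<epsilon> check P f)"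
    if \<sigma>: "q \<preceq> p" "name \<sigma>" "q \<tturnstile> \<sigma> \<epsilon> e i" for q \<sigma>
  proof (rule dense_belowI)
    fix r
    assume "r \<preceq> q"
    then obtain s a where s: "s \<preceq> r" "a \<in> B" "s \<tturnstile> \<sigma> \<approx> check P a"
      using B[OF \<sigma>] unfolding dense_below_def by blast
    then have "s \<tturnstile> opn \<sigma> (check P (k a)) \<epsilon> check P f"
      by (intro forces_opn_mem_checkI[OF _ forces_eq_refl]) (auto simp: f)
    moreover have "s \<tturnstile> check P (k a) \<epsilon> check P omega"
      by (rule forces_check_mem) (auto simp: mem_omega k_def)
    ultimately show "\<exists>s. s \<preceq> r \<and> (\<exists>\<upsilon>. name \<upsilon> \<and> s \<tturnstile> \<upsilon> \<epsilon> check P omega \<and> s \<tturnstile> opn \<sigma> \<upsilon> \<epsilon> check P f)"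
      using s(1) name_check by blast
  qed
  have functional: "q \<tturnstile> \<upsilon> \<approx> \<upsilon>'"
    if opn: "q \<tturnstile> opn \<sigma> \<upsilon> \<epsilon> check P f" "q \<tturnstile> opn \<sigma> \<upsilon>' \<epsilon> check P f" for q \<sigma> \<upsilon> \<upsilon>'
  proof (rule dense_forces_eq, rule dense_belowI)
    fix r
    assume r: "r \<preceq> q"
    obtain s a where s: "s \<preceq> r" "s \<tturnstile> \<sigma> \<approx> check P a" "s \<tturnstile> \<upsilon> \<approx> check P (k a)"
      using dense_belowD[OF rel[OF opn(1)] r] by blast
    obtain t b where t: "t \<preceq> s" "t \<tturnstile> \<sigma> \<approx> check P b" "t \<tturnstile> \<upsilon>' \<approx> check P (k b)"
      using dense_belowD[OF rel[OF opn(2)] le_trans[OF s(1) r]] by blast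
    have "t \<tturnstile> check P a \<approx> check P b"
      using forces_eq_trans[OF forces_eq_sym[OF forces_eq_mono[OF s(2) t(1)]] t(2)] .
    then have "a = b"
      using forces_check_eqD le_carrier[OF t(1)] by blast
    then have "t \<tturnstile> \<upsilon> \<approx> \<upsilon>'"
      using forces_eq_mono[OF s(3) t(1)] forces_eq_sym[OF t(3)] forces_eq_trans by blast
    then show "\<exists>t. t \<preceq> r \<and> t \<tturnstile> \<upsilon> \<approx> \<upsilon>'"
      using le_trans[OF t(1) s(1)] by blast
  qed
  have injective: "q \<tturnstile> \<sigma> \<approx> \<sigma>'"
    if opn: "q \<tturnstile> opn \<sigma> \<upsilon> \<epsilon> check P f" "q \<tturnstile> opn \<sigma>' \<upsilon> \<epsilon> check P f" for q \<sigma> \<sigma>' \<upsilon>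
  proof (rule dense_forces_eq, rule dense_belowI)
    fix r
    assume r: "r \<preceq> q"
    obtain s a where s: "s \<preceq> r" "a \<in> B" "s \<tturnstile> \<sigma> \<approx> check P a" "s \<tturnstile> \<upsilon> \<approx> check P (k a)"
      using dense_belowD[OF rel[OF opn(1)] r] by blast
    obtain t b where t: "t \<preceq> s" "b \<in> B" "t \<tturnstile> \<sigma>' \<approx> check P b" "t \<tturnstile> \<upsilon> \<approx> check P (k b)"
      using dense_belowD[OF rel[OF opn(2)] le_trans[OF s(1) r]] by blast
    have "t \<tturnstile> check P (k a) \<approx> check P (k b)"
      using forces_eq_trans[OF forces_eq_sym[OF forces_eq_mono[OF s(4) t(1)]] t(4)] .
    then have "k a = k b"
      using forces_check_eqD le_carrier[OF t(1)] by blast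
    then have "a = b"
      using k s(2) t(2) by blast
    then have "t \<tturnstile> \<sigma> \<approx> \<sigma>'"
      using forces_eq_mono[OF s(3) t(1)] forces_eq_sym[OF t(3)] forces_eq_trans by blast
    then show "\<exists>t. t \<preceq> r \<and> t \<tturnstile> \<sigma> \<approx> \<sigma>'"
      using le_trans[OF t(1) s(1)] by blast
  qed
  let ?e = "e(6 := check P omega, 7 := check P f)"
  have "forces P R p (AllIn 4 i (ExIn 5 6 (fm_rel 7 4 5))) ?e"
    unfolding forces_AllIn
  proof (intro allI impI)
    fix \<sigma> q
    assume \<sigma>: "name \<sigma>" "q \<preceq> p" "q \<tturnstile> \<sigma> \<epsilon> (?e(4 := \<sigma>)) i"
    then show "forces P R q (ExIn 5 6 (fm_rel 7 4 5)) (?e(4 := \<sigma>))"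
      using total[OF \<sigma>(2,1)] i by (simp add: forces_ExIn forces_fm_rel cong: conj_cong)
  qed
  moreover have "forces P R p (AllIn 4 i (All 5 (All 8
      (Imp (Conj (fm_rel 7 4 5) (fm_rel 7 4 8)) (Equal 5 8))))) ?e"
    unfolding forces_AllIn forces.simps(5) forces_Imp
  proof (intro allI impI)
    fix \<sigma> q \<upsilon> \<upsilon>' r
    assume "name \<sigma>" "name \<upsilon>" "name \<upsilon>'"
      and "forces P R r (Conj (fm_rel 7 4 5) (fm_rel 7 4 8)) (?e(4 := \<sigma>, 5 := \<upsilon>, 8 := \<upsilon>'))"
    then show "forces P R r (Equal 5 8) (?e(4 := \<sigma>, 5 := \<upsilon>, 8 := \<upsilon>'))"
      using functional by (auto simp: forces_fm_rel)
  qed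
  moreover have "forces P R p (AllIn 4 i (AllIn 5 i (All 8
      (Imp (Conj (fm_rel 7 4 8) (fm_rel 7 5 8)) (Equal 4 5))))) ?e"
    unfolding forces_AllIn forces.simps(5) forces_Imp
  proof (intro allI impI)
    fix \<sigma> q \<sigma>' q' \<upsilon> r
    assume "name \<sigma>" "name \<sigma>'" "name \<upsilon>"
      and "forces P R r (Conj (fm_rel 7 4 8) (fm_rel 7 5 8)) (?e(4 := \<sigma>, 5 := \<sigma>', 8 := \<upsilon>))"
    then show "forces P R r (Equal 4 5) (?e(4 := \<sigma>, 5 := \<sigma>', 8 := \<upsilon>))"
      using injective by (auto simp: forces_fm_rel)
  qed
  moreover have "forces P R p (fm_omega 6) (e(6 := check P omega))"
    by (rule forces_fm_omega) simp_all
  ultimately show ?thesis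
    unfolding fm_countable_def
    by (intro forces_ExI[OF name_check[of omega]] forces.simps(4)[THEN iffD2] conjI
        forces_ExI[OF name_check[of f]])
qed

text \<open>A common extension found in the ground model remains one, since canonical names preserve
  membership. It is used contrapositively: elements forced to be incompatible are incompatible in
  the ground model.\<close>

lemma forces_check_compatible:
  assumes "forcing Q S" "compatible Q S a b"
  shows "dense_below p (\<lambda>q. \<exists>\<tau>. name \<tau> \<and> q \<tturnstile> \<tau> \<epsilon> check P Q \<and>
    q \<tturnstile> opn \<tau> (check P a) \<epsilon> check P S \<and> q \<tturnstile> opn \<tau> (check P b) \<epsilon> check P S)"
proof -
  obtain c where c: "c \<in>\<^sub>V Q" "pair c a \<in>\<^sub>V S" "pair c b \<in>\<^sub>V S"
    using assms(2) by (auto simp: compatible_def le_def)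
  have "q \<tturnstile> check P c \<epsilon> check P Q" "q \<tturnstile> opn (check P c) (check P a) \<epsilon> check P S"
    "q \<tturnstile> opn (check P c) (check P b) \<epsilon> check P S" for q
    using c by (auto intro: forces_check_mem forces_opn_mem_checkI forces_eq_refl)
  then show ?thesis
    using name_check by (blast intro: dense_below_all)
qed

text \<open>By \<open>dense_forces\<close> it suffices to find, below each \<open>q\<close> under a
  condition forcing \<tau> to be an antichain of \<open>Q\<close>, some \<open>p'\<close> forcing
  \<tau> to be countable.\<close>

theorem ccc_preserved:
  assumes "almost_strongly_proper P R" and "forcing Q S" and "ccc Q S"
  shows "holds_in_generic_extensions P R fm_ccc ((\<lambda>_. check P Q)(1 := check P S))"
proof -
  let ?e = "\<lambda>\<tau>. (\<lambda>_. check P Q)(1 := check P S, 2 := \<tau>)"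
  have "forces P R p (fm_countable 2) (?e \<tau>)"
    if \<tau>: "name \<tau>" and sub: "forces P R p (AllIn 3 2 (Mem 3 0)) (?e \<tau>)"
      and anti: "forces P R p (AllIn 3 2 (AllIn 4 2
        (Imp (Neg (Equal 3 4)) (Neg (fm_compatible 0 1 3 4))))) (?e \<tau>)" for p \<tau>
  proof (rule dense_forces, rule dense_belowI)
    fix q
    assume q: "q \<preceq> p"
    have in_Q: "r \<tturnstile> \<sigma> \<epsilon> check P Q" if "r \<preceq> p" "name \<sigma>" "r \<tturnstile> \<sigma> \<epsilon> \<tau>" for r \<sigma>
      using sub that by (simp add: forces_AllIn)
    have "a = b" if r: "r \<preceq> q" and "a \<in>\<^sub>V Q" "b \<in>\<^sub>V Q"
      "r \<tturnstile> check P a \<epsilon> \<tau>" "r \<tturnstile> check P b \<epsilon> \<tau>" and comp: "compatible Q S a b" for r a b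
    proof (rule ccontr)
      assume "a \<noteq> b"
      let ?e' = "(?e \<tau>)(3 := check P a, 4 := check P b)"
      have "forces P R r (Imp (Neg (Equal 3 4)) (Neg (fm_compatible 0 1 3 4))) ?e'"
        using anti that le_trans[OF r q] le_refl'[OF r] unfolding forces_AllIn by simp
      \<comment> \<open>No condition in \<open>P\<close> forces the canonical names of distinct sets
        to be equal.\<close>
      moreover have "forces P R r (Neg (Equal 3 4)) ?e'"
        using \<open>a \<noteq> b\<close> forces_check_eqD le_carrier by auto
      ultimately have "forces P R r (Neg (fm_compatible 0 1 3 4)) ?e'"
        using le_refl'[OF r] unfolding forces_Imp by blast
      moreover have "forces P R r (fm_compatible 0 1 3 4) ?e'"
        using forces_check_compatible[OF assms(2) comp] by (simp add: forces_fm_compatible)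
      ultimately show False
        using le_refl'[OF r] by simp
    qed
    then obtain p' B where p': "p' \<preceq> q" and B: "countable B"
      "\<And>r a. r \<preceq> p' \<Longrightarrow> a \<in>\<^sub>V Q \<Longrightarrow> r \<tturnstile> check P a \<epsilon> \<tau> \<Longrightarrow> a \<in> B"
      using antichain_countable_cover[OF assms, of q \<tau>] le_carrier[OF q] by metis
    have "forces P R p' (fm_countable 2) (?e \<tau>)"
    proof (rule forces_fm_countable[OF _ _ B(1)])
      fix r \<sigma>
      assume r: "r \<preceq> p'" and \<sigma>: "name \<sigma>" "r \<tturnstile> \<sigma> \<epsilon> ?e \<tau> 2"
      then have "r \<tturnstile> \<sigma> \<epsilon> check P Q"
        using in_Q le_trans[OF r le_trans[OF p' q]] by simp
      \<comment> \<open>Densely, \<sigma> equals the canonical name of some element of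
        \<open>Q\<close>, and the choice of \<open>p'\<close> puts this element into
        \<open>B\<close>.\<close>
      then show "dense_below r (\<lambda>s. \<exists>a\<in>B. s \<tturnstile> \<sigma> \<approx> check P a)"
        unfolding forces_mem_check
      proof (rule dense_below_mono, elim exE conjE)
        fix s a
        assume s: "s \<preceq> r" "a \<in>\<^sub>V Q" "s \<tturnstile> \<sigma> \<approx> check P a"
        then have "s \<tturnstile> check P a \<epsilon> \<tau>"
          using forces_mem_cong[OF forces_mem_mono[OF _ s(1)] s(3) forces_eq_refl] \<sigma>(2) by simp
        then have "a \<in> B"
          using B(2) s(2) le_trans[OF s(1) r] by blast
        then show "dense_below s (\<lambda>s. \<exists>a\<in>B. s \<tturnstile> \<sigma> \<approx> check P a)"
          using s(3) forces_eq_mono by (blast intro: dense_below_all)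
      qed
    qed (use \<tau> in simp_all)
    then show "\<exists>r. r \<preceq> q \<and> forces P R r (fm_countable 2) (?e \<tau>)"
      using p' by blast
  qed
  then show ?thesis
    unfolding holds_in_generic_extensions_def fm_ccc_def forces.simps(5) forces_Imp forces.simps(4)
    by blast
qed

end

theorem proposition1p6:
  fixes P leP Q leQ :: "'v::zfc"
  assumes "forcing P leP" and "almost_strongly_proper P leP"
    and "forcing Q leQ" and "ccc Q leQ"
  shows "holds_in_generic_extensions P leP fm_ccc ((\<lambda>_. check P Q)(1 := check P leQ))"
  using forcing_notion.ccc_preserved[OF forcing_notion.intro[OF assms(1)] assms(2-4)] .

end
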